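(* Let $g\ge3$ and $a_1\ge a_2\ge1$ be integers, and suppose the unicyclic graph $U_g^{a_1,a_2}$ has order $n=g+a_1+a_2=q^2+r$ with integers $q\ge1$ and $1\le r\le 2q+1$. Suppose $1\le r\le 2q-2$ and that one of the following holds: (1) $r+1\le g\le 2q-1$, $a_1\le q^2-\lfloor\frac g2\rfloor-1$ and $(g,a_1,a_2)\notin\mathcal B$; or (2) $2q\le g\le q^2$, $a_2\ge r-q+1$ and $(g,a_1,a_2)\notin\bigcup_{i=1}^6\mathcal C_i$. Then $b(U_g^{a_1,a_2})=\lceil\sqrt n\,\rceil-1=q$.
   Context: All graphs are finite and simple. Burning number: at time $0$ all vertices of $G$ are unburned. In each round $t\ge1$, one new unburned vertex is chosen to burn (if such a vertex exists), and every unburned neighbour of a vertex that was burned by the end of the previous round becomes burned; burned vertices stay burned. The process ends when all vertices are burned. $b(G)$ is the smallest $k$ such that $G$ can be completely burned within $k$ rounds by a suitable choice of vertices. $U_g^{a_1,a_2}$ (with $a_1\ge a_2\ge 1$) is the unicyclic graph of order $n=g+a_1+a_2$ obtained from a cycle $C_g=v_1v_2\cdots v_gv_1$ by attaching two paths at $v_g$, contributing $a_1$ and $a_2$ new vertices respectively, one end of each being adjacent to $v_g$. The following sets of triples depend on $q$ and $r$ (where $n=q^2+r$). $\mathcal B=\{(2q-2,q^2-q-2,q+1),(2q-1,q^2-q-2,q+1)\}$. $B_1=\{(q^2-2,q,q),(q^2-6,q+2,q+2),(q^2-10,q+4,q+4),(q^2-3,q+1,q),(q^2-5,q+3,q),(q^2-7,q+3,q+2),(q^2-8,q+3,q+3),(q^2-7,q+5,q),(q^2-10,q+5,q+3),(q^2-11,q+5,q+4),(q^2-12,q+5,q+5),(q^2-14,q+6,q+6),(q^2-12,q+7,q+3),(q^2-14,q+7,q+5),(q^2-14,q+9,q+3)\}$.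 $B_2=\{(2q,q^2-q-2,q),(2q+2,q^2-q-6,q+2),(2q+4,q^2-q-10,q+4),(2q+1,q^2-q-3,q),(2q+3,q^2-q-5,q),(2q+3,q^2-q-7,q+2),(2q+3,q^2-q-8,q+3),(2q+5,q^2-q-7,q),(2q+5,q^2-q-10,q+3),(2q+5,q^2-q-11,q+4),(2q+5,q^2-q-12,q+5),(2q+6,q^2-q-14,q+6),(2q+7,q^2-q-12,q+3),(2q+7,q^2-q-14,q+5),(2q+9,q^2-q-14,q+3)\}$. $B_3=\{(2q,q^2-q-3,q+1),(2q,q^2-q-5,q+3),(2q+2,q^2-q-7,q+3),(2q,q^2-q-7,q+5),(2q+3,q^2-q-10,q+5),(2q+4,q^2-q-11,q+5),(2q+3,q^2-q-12,q+7),(2q+5,q^2-q-14,q+7),(2q+3,q^2-q-14,q+9)\}$. $B_4=\{(24,16,6),(22,16,8),(35,19,7),(32,19,10),(30,19,12),(28,19,14),(26,19,16),(30,21,10),(28,21,12),(45,22,11),(43,22,13),(41,22,15),(34,22,22),(43,24,11),(41,24,13),(32,24,22),(41,26,11),(60,25,12),(58,25,14),(47,25,25),(58,27,12),(47,38,12),(77,28,13)\}$. $B_5=\{(22,18,6),(22,16,8),(26,28,7),(26,25,10),(26,23,12),(26,21,14),(26,19,16),(28,23,10),(28,21,12),(30,37,11),(30,35,13),(30,33,15),(30,26,22),(32,35,11),(32,33,13),(32,24,22),(34,33,11),(34,51,12),(34,49,14),(34,38,25),(36,49,12),(47,38,12),(38,67,13)\}$. $B_6=\{(12,18,16),(14,16,16),(14,28,19),(17,25,19),(19,23,19),(21,21,19),(23,19,19),(17,23,21),(19,21,21),(19,37,22),(21,35,22),(23,33,22),(30,26,22),(19,35,24),(21,33,24),(30,24,24),(19,33,26),(21,51,25),(23,49,25),(34,38,25),(21,49,27),(21,38,38),(23,67,28)\}$.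 $\mathcal C_1=\{(2q+1,q^2-q-2,r-q+1),(q^2-2,q+1,r-q+1)\}$. $\mathcal C_2=\{(q^2-7,q+2,q+1),(2q+1,q^2-q-6,q+1),(2q+1,q^2-q-7,q+2)\}$. $\mathcal C_3=\{(q^2-3,q,q),(q^2-5,q+1,q+1),(q^2-6,q+2,q+1),(q^2-7,q+2,q+2),(q^2-7,q+3,q+1),(q^2-11,q+4,q+4),(2q+4,q^2-q-11,q+4),(2q+1,q^2-q-5,q+1),(2q+1,q^2-q-6,q+2),(2q+1,q^2-q-7,q+3),(2q+2,q^2-q-6,q+1),(2q+2,q^2-q-7,q+2),(2q+3,q^2-q-7,q+1),(2q,q^2-q-3,q),(22,16,7),(13,16,16)\}$. $\mathcal C_4=\{(g,a_1,a_2): n=q^2+2q-2,\ g-q\ge a_1\ge a_2=q+1\}\cup B_1\cup B_4$. $\mathcal C_5=\{(g,a_1,a_2): n=q^2+2q-2,\ a_1\ge g-q\ge a_2=q+1\}\cup B_2\cup B_5$. $\mathcal C_6=\{(g,a_1,a_2): n=q^2+2q-2,\ a_1\ge a_2\ge g-q=q+1\}\cup B_3\cup B_6$. In $\mathcal C_4,\mathcal C_5,\mathcal C_6$, $n=g+a_1+a_2$. *)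

theory Defs
  imports Complex_Main "Graph_Theory.Pair_Digraph"
begin

text \<open>A finite simple graph is a \<open>pair_graph\<close>: an undirected edge is a pair of opposite arcs.\<close>

definition nbrs :: "'a pair_pre_digraph \<Rightarrow> 'a set \<Rightarrow> 'a set" where
  "nbrs G S = {w \<in> pverts G. \<exists>u\<in>S. (u, w) \<in> parcs G}"

text \<open>
  \<open>burned_after G t S\<close>: some run of the process has exactly the vertices in \<open>S\<close> burned at the
  end of round \<open>t\<close>. The vertex chosen in a round is unburned at the end of the previous round; it
  may be one that the fire reaches in the same round.
\<close>

inductive burned_after :: "'a pair_pre_digraph \<Rightarrow> nat \<Rightarrow> 'a set \<Rightarrow> bool"
  for G :: "'a pair_pre_digraph" where
  start: "burned_after G 0 {}"
| ignite: "burned_after G t S \<Longrightarrow> v \<in> pverts G - S \<Longrightarrow>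
    burned_after G (Suc t) (S \<union> nbrs G S \<union> {v})"
| finished: "burned_after G t S \<Longrightarrow> pverts G - S = {} \<Longrightarrow> burned_after G (Suc t) S"

definition burning_number :: "'a pair_pre_digraph \<Rightarrow> nat" where
  "burning_number G = (LEAST k. burned_after G k (pverts G))"

lemma burned_after_subset: "burned_after G t S \<Longrightarrow> S \<subseteq> pverts G"
  by (induction rule: burned_after.induct) (auto simp: nbrs_def)

text \<open>The minimum defining \<open>burning_number\<close> is attained on every finite graph.\<close>

lemma burned_after_burning_number:
  assumes "finite (pverts G)"
  shows "burned_after G (burning_number G) (pverts G)"
proof -
  have ex: "\<exists>S. burned_after G t S \<and> (t \<le> card S \<or> S = pverts G)" for t
  proof (induction t)
    case 0
    show ?case by (auto intro: burned_after.start)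
  next
    case (Suc t)
    then obtain S where S: "burned_after G t S" "t \<le> card S \<or> S = pverts G" by blast
    have sub: "S \<subseteq> pverts G" using S(1) by (rule burned_after_subset)
    show ?case
    proof (cases "S = pverts G")
      case True
      then show ?thesis using S(1) burned_after.finished by fastforce
    next
      case False
      then obtain v where v: "v \<in> pverts G - S" using sub by blast
      let ?T = "S \<union> nbrs G S \<union> {v}"
      have b: "burned_after G (Suc t) ?T" using S(1) v by (rule burned_after.ignite)
      have fin: "finite ?T"
        using burned_after_subset[OF b] assms by (rule finite_subset)
      have "S \<subset> ?T" using v by blast
      then have "card S < card ?T" using fin by (intro psubset_card_mono)
      then show ?thesis using b S(2) False by (intro exI[of _ ?T]) linarith
    qed
  qed
  obtain S where S: "burned_after G (Suc (card (pverts G))) S"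
    "Suc (card (pverts G)) \<le> card S \<or> S = pverts G" using ex by blast
  have "card S \<le> card (pverts G)"
    using burned_after_subset[OF S(1)] assms by (rule card_mono[rotated])
  then have "burned_after G (Suc (card (pverts G))) (pverts G)" using S by auto
  then show ?thesis unfolding burning_number_def by (rule LeastI)
qed


text \<open>
  \<open>Cyc i\<close> is the cycle vertex \<open>v\<^sub>i\<close>; \<open>Leg1 i\<close> and \<open>Leg2 i\<close> are the vertices of the two
  attached paths, at distance \<open>i\<close> from \<open>v\<^sub>g\<close>.
\<close>

datatype uvertex = Cyc int | Leg1 int | Leg2 int

definition unicyclic_edges :: "int \<Rightarrow> int \<Rightarrow> int \<Rightarrow> uvertex rel" where
  "unicyclic_edges g a1 a2 =
     {(Cyc i, Cyc (i + 1)) | i. 1 \<le> i \<and> i < g} \<union> {(Cyc g, Cyc 1)} \<union>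
     {(Cyc g, Leg1 1)} \<union> {(Leg1 i, Leg1 (i + 1)) | i. 1 \<le> i \<and> i < a1} \<union>
     {(Cyc g, Leg2 1)} \<union> {(Leg2 i, Leg2 (i + 1)) | i. 1 \<le> i \<and> i < a2}"

text \<open>The graph \<open>U\<^sub>g\<close> with legs \<open>a1\<close>, \<open>a2\<close>; meaningful for \<open>g \<ge> 3\<close> and \<open>a1, a2 \<ge> 1\<close>.\<close>

definition unicyclic :: "int \<Rightarrow> int \<Rightarrow> int \<Rightarrow> uvertex pair_pre_digraph" where
  "unicyclic g a1 a2 =
     \<lparr> pverts = Cyc ` {1..g} \<union> Leg1 ` {1..a1} \<union> Leg2 ` {1..a2},
       parcs = unicyclic_edges g a1 a2 \<union> (unicyclic_edges g a1 a2)\<inverse> \<rparr>"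

lemma pair_graph_unicyclic:
  assumes "g \<ge> 3" "a1 \<ge> 1" "a2 \<ge> 1"
  shows "pair_graph (unicyclic g a1 a2)"
proof -
  have fv: "finite (pverts (unicyclic g a1 a2))" by (simp add: unicyclic_def)
  have sub: "parcs (unicyclic g a1 a2) \<subseteq> pverts (unicyclic g a1 a2) \<times> pverts (unicyclic g a1 a2)"
    using assms by (auto simp: unicyclic_def unicyclic_edges_def)
  have fa: "finite (parcs (unicyclic g a1 a2))"
    by (rule finite_subset[OF sub]) (use fv in simp)
  have sy: "symmetric (with_proj (unicyclic g a1 a2))"
    unfolding symmetric_def by (auto simp: unicyclic_def intro!: symI)
  show ?thesis
    using assms sub fv fa sy
    by unfold_locales (auto simp: unicyclic_def unicyclic_edges_def)
qed

lemma card_unicyclic: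
  assumes "g \<ge> 0" "a1 \<ge> 0" "a2 \<ge> 0"
  shows "int (card (pverts (unicyclic g a1 a2))) = g + a1 + a2"
proof -
  have "card (pverts (unicyclic g a1 a2))
      = card (Cyc ` {1..g} \<union> Leg1 ` {1..a1}) + card (Leg2 ` {1..a2})"
    unfolding unicyclic_def by (simp, subst card_Un_disjoint) auto
  also have "card (Cyc ` {1..g} \<union> Leg1 ` {1..a1}) = card (Cyc ` {1..g}) + card (Leg1 ` {1..a1})"
    by (subst card_Un_disjoint) auto
  finally show ?thesis using assms by (simp add: card_image inj_on_def)
qed


text \<open>Exceptional triples \<open>(g, a1, a2)\<close>, for order \<open>q\<^sup>2 + r\<close>.\<close>

definition B_exc :: "int \<Rightarrow> (int \<times> int \<times> int) set" where
  "B_exc q = {(2*q-2, q^2-q-2, q+1), (2*q-1, q^2-q-2, q+1)}"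

definition B1 :: "int \<Rightarrow> (int \<times> int \<times> int) set" where
  "B1 q =
     {(q^2-2, q, q), (q^2-6, q+2, q+2), (q^2-10, q+4, q+4), (q^2-3, q+1, q), (q^2-5, q+3, q),
      (q^2-7, q+3, q+2), (q^2-8, q+3, q+3), (q^2-7, q+5, q), (q^2-10, q+5, q+3),
      (q^2-11, q+5, q+4), (q^2-12, q+5, q+5), (q^2-14, q+6, q+6), (q^2-12, q+7, q+3),
      (q^2-14, q+7, q+5), (q^2-14, q+9, q+3)}"

definition B2 :: "int \<Rightarrow> (int \<times> int \<times> int) set" where
  "B2 q =
     {(2*q, q^2-q-2, q), (2*q+2, q^2-q-6, q+2), (2*q+4, q^2-q-10, q+4), (2*q+1, q^2-q-3, q),
      (2*q+3, q^2-q-5, q), (2*q+3, q^2-q-7, q+2), (2*q+3, q^2-q-8, q+3), (2*q+5, q^2-q-7, q),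
      (2*q+5, q^2-q-10, q+3), (2*q+5, q^2-q-11, q+4), (2*q+5, q^2-q-12, q+5),
      (2*q+6, q^2-q-14, q+6), (2*q+7, q^2-q-12, q+3), (2*q+7, q^2-q-14, q+5),
      (2*q+9, q^2-q-14, q+3)}"

definition B3 :: "int \<Rightarrow> (int \<times> int \<times> int) set" where
  "B3 q =
     {(2*q, q^2-q-3, q+1), (2*q, q^2-q-5, q+3), (2*q+2, q^2-q-7, q+3), (2*q, q^2-q-7, q+5),
      (2*q+3, q^2-q-10, q+5), (2*q+4, q^2-q-11, q+5), (2*q+3, q^2-q-12, q+7),
      (2*q+5, q^2-q-14, q+7), (2*q+3, q^2-q-14, q+9)}"

definition B4 :: "(int \<times> int \<times> int) set" where
  "B4 =
     {(24, 16, 6), (22, 16, 8), (35, 19, 7), (32, 19, 10), (30, 19, 12), (28, 19, 14),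
      (26, 19, 16), (30, 21, 10), (28, 21, 12), (45, 22, 11), (43, 22, 13), (41, 22, 15),
      (34, 22, 22), (43, 24, 11), (41, 24, 13), (32, 24, 22), (41, 26, 11), (60, 25, 12),
      (58, 25, 14), (47, 25, 25), (58, 27, 12), (47, 38, 12), (77, 28, 13)}"

definition B5 :: "(int \<times> int \<times> int) set" where
  "B5 =
     {(22, 18, 6), (22, 16, 8), (26, 28, 7), (26, 25, 10), (26, 23, 12), (26, 21, 14),
      (26, 19, 16), (28, 23, 10), (28, 21, 12), (30, 37, 11), (30, 35, 13), (30, 33, 15),
      (30, 26, 22), (32, 35, 11), (32, 33, 13), (32, 24, 22), (34, 33, 11), (34, 51, 12),
      (34, 49, 14), (34, 38, 25), (36, 49, 12), (47, 38, 12), (38, 67, 13)}"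

definition B6 :: "(int \<times> int \<times> int) set" where
  "B6 =
     {(12, 18, 16), (14, 16, 16), (14, 28, 19), (17, 25, 19), (19, 23, 19), (21, 21, 19),
      (23, 19, 19), (17, 23, 21), (19, 21, 21), (19, 37, 22), (21, 35, 22), (23, 33, 22),
      (30, 26, 22), (19, 35, 24), (21, 33, 24), (30, 24, 24), (19, 33, 26), (21, 51, 25),
      (23, 49, 25), (34, 38, 25), (21, 49, 27), (21, 38, 38), (23, 67, 28)}"

definition C1 :: "int \<Rightarrow> int \<Rightarrow> (int \<times> int \<times> int) set" where
  "C1 q r =
     {(2*q+1, q^2-q-2, r-q+1), (q^2-2, q+1, r-q+1)}"

definition C2 :: "int \<Rightarrow> (int \<times> int \<times> int) set" where
  "C2 q =
     {(q^2-7, q+2, q+1), (2*q+1, q^2-q-6, q+1), (2*q+1, q^2-q-7, q+2)}"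

definition C3 :: "int \<Rightarrow> (int \<times> int \<times> int) set" where
  "C3 q =
     {(q^2-3, q, q), (q^2-5, q+1, q+1), (q^2-6, q+2, q+1), (q^2-7, q+2, q+2),
      (q^2-7, q+3, q+1), (q^2-11, q+4, q+4), (2*q+4, q^2-q-11, q+4), (2*q+1, q^2-q-5, q+1),
      (2*q+1, q^2-q-6, q+2), (2*q+1, q^2-q-7, q+3), (2*q+2, q^2-q-6, q+1),
      (2*q+2, q^2-q-7, q+2), (2*q+3, q^2-q-7, q+1), (2*q, q^2-q-3, q), (22, 16, 7),
      (13, 16, 16)}"

definition C4 :: "int \<Rightarrow> (int \<times> int \<times> int) set" where
  "C4 q =
     {(g, a1, a2). g + a1 + a2 = q^2 + 2*q - 2 \<and> g - q \<ge> a1 \<and> a1 \<ge> a2 \<and> a2 = q + 1}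
     \<union> B1 q \<union> B4"

definition C5 :: "int \<Rightarrow> (int \<times> int \<times> int) set" where
  "C5 q =
     {(g, a1, a2). g + a1 + a2 = q^2 + 2*q - 2 \<and> a1 \<ge> g - q \<and> g - q \<ge> a2 \<and> a2 = q + 1}
     \<union> B2 q \<union> B5"

definition C6 :: "int \<Rightarrow> (int \<times> int \<times> int) set" where
  "C6 q =
     {(g, a1, a2). g + a1 + a2 = q^2 + 2*q - 2 \<and> a1 \<ge> a2 \<and> a2 \<ge> g - q \<and> g - q = q + 1}
     \<union> B3 q \<union> B6"

end

theory Submission
  imports Defs
begin

text \<open>
  A run of \<open>k\<close> rounds burns exactly what \<open>k\<close> balls of radii \<open>0, \<dots>, k - 1\<close> can cover, so the
  burning number is a covering number (\<open>burned_after_if_covered\<close>, \<open>covered_if_burned_after\<close>).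

  Lower bound. On a path or a cycle a ball of radius \<open>i\<close> has at most \<open>2i + 1\<close> vertices. In
  \<open>U\<^sub>g\<close> a ball gains by spilling over the branch vertex \<open>v\<^sub>g\<close>, but what it spills lies in a ball
  around \<open>v\<^sub>g\<close>; among these nested balls only the largest, of some radius \<open>s \<le> k - 1\<close>, counts, and it adds
  at most \<open>2s\<close> vertices. Hence \<open>k\<close> rounds burn at most \<open>k\<^sup>2 + 2(k - 1)\<close> vertices
  (\<open>card_le_if_covered\<close>). For \<open>k = q - 1\<close> this is \<open>q\<^sup>2 - 3 < n\<close>.

  Upper bound. Put \<open>m = q - 1\<close> and place the ball of radius \<open>m\<close> on or near \<open>v\<^sub>g\<close>. What remains is
  a union of at most three paths, to be covered by balls of radii \<open>0, \<dots>, m - 1\<close>, that is, by paths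
  with \<open>1, 3, \<dots>, 2m - 1\<close> vertices. So the question becomes when the first \<open>m\<close> odd numbers can be
  divided into three groups whose sums reach three given lengths. If the lengths add up to \<open>m\<^sup>2\<close>,
  the obstructions are a length \<open>2\<close>, one of fourteen pairs of small lengths, and finitely many
  sporadic triples with \<open>m \<le> 9\<close> (\<open>odd_cover_slack0\<close>). This is an induction on \<open>m\<close> that subtracts
  \<open>2m - 1\<close> from one of the lengths, with the cases \<open>m \<le> 10\<close> computed. If the lengths add up to less
  than \<open>m\<^sup>2\<close>, they may be enlarged first, and the obstructions disappear one after another as the
  slack grows (\<open>odd_cover_slack1\<close> to \<open>odd_cover_slack4\<close>).

  If \<open>g \<ge> 2q\<close> and both legs are longer than \<open>m\<close>, the ball is centred at \<open>v\<^sub>g\<close>, or one step into a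
  leg if the slack is \<open>2\<close> or \<open>3\<close> and \<open>v\<^sub>g\<close> itself does not work; the obstructions that survive are
  the exceptional families \<open>C2\<close> to \<open>C6\<close> (\<open>shift_cover_unless_exceptional\<close>). If the shorter leg lies
  inside the ball, only two paths remain, with a length \<open>2\<close> as the sole obstruction, which
  gives \<open>C1\<close>. If \<open>g < 2q\<close>, the centre moves into the longer leg as far as the ball still covers the
  cycle; again two paths remain, and stepping back by one resolves a length \<open>2\<close> unless the centre
  is already at \<open>v\<^sub>g\<close>, which gives \<open>B_exc\<close>.
\<close>

section \<open>Covering three lengths with the odd numbers\<close>

text \<open>
  The numbers \<open>1, 3, \<dots>, 2m - 1\<close> are the orders of the paths that balls of radii \<open>0, \<dots>, m - 1\<close>
  cover, and each of them is given to one of three paths of orders \<open>x\<close>, \<open>y\<close>, \<open>z\<close>. A length may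
  become negative: it is then covered with something to spare. Working with \<open>int\<close> and \<open>\<le> 0\<close> makes the
  predicate antitone in the lengths.
\<close>
fun odd_cover :: "nat \<Rightarrow> int \<Rightarrow> int \<Rightarrow> int \<Rightarrow> bool" where
  "odd_cover 0 x y z \<longleftrightarrow> x \<le> 0 \<and> y \<le> 0 \<and> z \<le> 0"
| "odd_cover (Suc m) x y z \<longleftrightarrow>
     odd_cover m (x - (2 * int m + 1)) y z \<or>
     odd_cover m x (y - (2 * int m + 1)) z \<or>
     odd_cover m x y (z - (2 * int m + 1))"

lemma odd_cover_swap12: "odd_cover m x y z \<longleftrightarrow> odd_cover m y x z"
  by (induction m arbitrary: x y z) auto

lemma odd_cover_swap23: "odd_cover m x y z \<longleftrightarrow> odd_cover m x z y"
  by (induction m arbitrary: x y z) auto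

lemma odd_cover_mono:
  "odd_cover m x y z \<Longrightarrow> x' \<le> x \<Longrightarrow> y' \<le> y \<Longrightarrow> z' \<le> z \<Longrightarrow> odd_cover m x' y' z'"
proof (induction m arbitrary: x y z x' y' z')
  case (Suc m)
  have d: "x' - (2 * int m + 1) \<le> x - (2 * int m + 1)" "y' - (2 * int m + 1) \<le> y - (2 * int m + 1)"
    "z' - (2 * int m + 1) \<le> z - (2 * int m + 1)" using Suc.prems by auto
  show ?case
    using Suc.prems(1) Suc.IH[OF _ d(1) Suc.prems(3,4)] Suc.IH[OF _ Suc.prems(2) d(2) Suc.prems(4)]
      Suc.IH[OF _ Suc.prems(2,3) d(3)] by auto
qed auto

text \<open>
  Two small lengths that cannot be served from disjoint sets of odd numbers without leaving a
  remainder. For example \<open>6\<close> must be \<open>5 + 1\<close>, so that nothing is left for \<open>1\<close>; and \<open>10\<close> must be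
  \<open>9 + 1\<close> or \<open>7 + 3\<close>, either of which spoils \<open>4 = 3 + 1\<close>.
\<close>
definition obstructing_pair :: "int \<Rightarrow> int \<Rightarrow> bool" where
  "obstructing_pair y z \<longleftrightarrow>
     (y, z) \<in> {(1, 1), (4, 1), (6, 1), (3, 3), (4, 3), (4, 4), (6, 4), (8, 4), (10, 4),
               (5, 5), (6, 5), (6, 6), (8, 6), (7, 7)}"

text \<open>
  The remaining failures. Typically a length slightly exceeds what \<open>j\<close> odd numbers up to \<open>2m - 1\<close> can
  add up to; by parity it then needs \<open>j + 2\<close> of them, and the small ones are already taken. In
  \<open>(58, 19, 4)\<close>, for instance, \<open>4 = 3 + 1\<close>, and \<open>19 > 17\<close> needs three numbers, but
  \<open>5 + 7 + 9 = 21\<close>. From \<open>m = 10\<close> on no such triple occurs.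
\<close>
definition sporadic_obstruction :: "int \<Rightarrow> int \<Rightarrow> int \<Rightarrow> int \<Rightarrow> bool" where
  "sporadic_obstruction m x y z \<longleftrightarrow>
     (m = 5 \<and> (x, y, z) \<in> {(13, 11, 1), (11, 11, 3)}) \<or>
     (m = 6 \<and> (x, y, z) \<in> {(22, 13, 1), (19, 13, 4), (17, 15, 4), (17, 13, 6), (15, 15, 6),
                          (15, 13, 8), (13, 13, 10)}) \<or>
     (m = 7 \<and> (x, y, z) \<in> {(30, 15, 4), (28, 17, 4), (26, 19, 4), (28, 15, 6), (26, 17, 6),
                          (26, 15, 8), (19, 15, 15), (17, 17, 15)}) \<or>
     (m = 8 \<and> (x, y, z) \<in> {(43, 17, 4), (41, 19, 4), (30, 30, 4), (41, 17, 6), (30, 17, 17)}) \<or>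
     (m = 9 \<and> (x, y, z) = (58, 19, 4))"

text \<open>
  Meant for \<open>x \<ge> y \<ge> z \<ge> 0\<close> of total \<open>m\<^sup>2\<close>. The number \<open>2\<close> is not a sum of distinct odd
  numbers, so without slack it can never occur as a length.
\<close>
definition obstructed :: "int \<Rightarrow> int \<Rightarrow> int \<Rightarrow> int \<Rightarrow> bool" where
  "obstructed m x y z \<longleftrightarrow> x = 2 \<or> y = 2 \<or> z = 2 \<or> obstructing_pair y z \<or> sporadic_obstruction m x y z"

text \<open>
  The same predicate with early exits, for the evaluation in \<open>split_steps_small\<close>: every obstructing
  pair has \<open>y \<le> 10\<close> and every sporadic triple has \<open>y \<ge> 11\<close>.
\<close>
lemma obstructed_code [code]:
  "obstructed m x y z \<longleftrightarrow>
     (if x = 2 \<or> y = 2 \<or> z = 2 then True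
      else if y \<le> 10 then obstructing_pair y z
      else if m < 5 \<or> 9 < m then False
      else sporadic_obstruction m x y z)"
  by (auto simp: obstructed_def obstructing_pair_def sporadic_obstruction_def)

text \<open>
  Absence of an obstruction for lengths in any order; a negative length counts as an obstruction,
  because the total is exactly \<open>m\<^sup>2\<close> in the intended use and any waste is fatal.
\<close>
definition splittable :: "int \<Rightarrow> int \<Rightarrow> int \<Rightarrow> int \<Rightarrow> bool" where
  "splittable m x y z \<longleftrightarrow>
     (let L = max x (max y z); S = min x (min y z)
      in if S < 0 then False else \<not> obstructed m L (x + y + z - L - S) S)"

lemma splittable_swap12: "splittable m x y z \<longleftrightarrow> splittable m y x z"
  by (auto simp: splittable_def Let_def max.left_commute min.left_commute max.commute min.commute ac_simps)

lemma splittable_swap23: "splittable m x y z \<longleftrightarrow> splittable m x z y"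
  by (auto simp: splittable_def Let_def max.commute min.commute ac_simps)

lemma splittable_sorted:
  "z \<le> y \<Longrightarrow> y \<le> x \<Longrightarrow> splittable m x y z \<longleftrightarrow> 0 \<le> z \<and> \<not> obstructed m x y z"
  by (auto simp: splittable_def Let_def)

lemma sorted_triple_cases [consumes 0, case_names swap12 swap23 sorted]:
  fixes x y z :: int
  assumes "\<And>x y z. P y x z \<Longrightarrow> P x y z" "\<And>x y z. P x z y \<Longrightarrow> P x y z"
    and "\<And>x y z. z \<le> y \<Longrightarrow> y \<le> x \<Longrightarrow> P x y z"
  shows "P x y z"
  using assms by (metis linear)

definition split_step :: "int \<Rightarrow> int \<Rightarrow> int \<Rightarrow> int \<Rightarrow> bool" where
  "split_step m x y z \<longleftrightarrow>
     (if splittable (m - 1) (x - (2 * m - 1)) y z then True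
      else if splittable (m - 1) x (y - (2 * m - 1)) z then True
      else splittable (m - 1) x y (z - (2 * m - 1)))"

text \<open>
  All triples \<open>x \<ge> y \<ge> z \<ge> 0\<close> of total \<open>m\<^sup>2\<close> are enumerated by \<open>z \<le> m\<^sup>2/3\<close> and
  \<open>y \<le> (m\<^sup>2 - z)/2\<close>.
\<close>
definition split_steps :: "int \<Rightarrow> bool" where
  "split_steps m \<longleftrightarrow>
     list_all (\<lambda>z. list_all (\<lambda>y. let x = m * m - y - z in
        if x < y then True else if obstructed m x y z then True else split_step m x y z)
       [z..(m * m - z) div 2]) [0..m * m div 3]"

lemma split_steps_small: "list_all split_steps [1..10]"
  by code_simp

text \<open>
  The induction step. From \<open>m = 11\<close> on, subtracting \<open>2m - 1\<close> from the largest length always works: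
  that length is at least \<open>m\<^sup>2/3\<close>, so at least \<open>19\<close> remains, which exceeds every entry of an
  obstructing pair. A new obstruction would have to come from the other two lengths, which have not
  changed.
\<close>
lemma split_step_exists:
  assumes "1 \<le> m" "0 \<le> z" "z \<le> y" "y \<le> x" "x + y + z = m * m" "\<not> obstructed m x y z"
  shows "split_step m x y z"
proof (cases "m \<le> 10")
  case True
  then have "split_steps m" using split_steps_small assms(1) by (simp add: list_all_iff)
  then have "list_all (\<lambda>y. let x = m * m - y - z in
        if x < y then True else if obstructed m x y z then True else split_step m x y z)
       [z..(m * m - z) div 2]"
    unfolding split_steps_def list_all_iff by (rule bspec) (use assms(2-5) in simp)
  then have "let x = m * m - y - z in
        if x < y then True else if obstructed m x y z then True else split_step m x y z"
    unfolding list_all_iff by (rule bspec) (use assms(2-5) in simp)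
  moreover have "m * m - y - z = x" using assms(5) by simp
  ultimately show ?thesis using assms(4,6) by (simp add: Let_def)
next
  case False
  have "11 * m \<le> m * m" using False by (intro mult_right_mono) auto
  moreover have "3 * x \<ge> m * m" using assms by linarith
  ultimately have x: "x - (2 * m - 1) \<ge> 19" using False by linarith
  have small: "y \<noteq> 2" "z \<noteq> 2" "\<not> obstructing_pair y z" "\<not> sporadic_obstruction (m - 1) u v w" for u v w
    using assms(6) False by (auto simp: obstructed_def sporadic_obstruction_def)
  consider "y \<le> x - (2 * m - 1)" | "x - (2 * m - 1) < y" "z \<le> x - (2 * m - 1)" | "x - (2 * m - 1) < z"
    by linarith
  then have "splittable (m - 1) (x - (2 * m - 1)) y z"
  proof cases
    case 1
    then show ?thesis
      using small x assms(2,3) by (subst splittable_sorted) (auto simp: obstructed_def)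
  next
    case 2
    then show ?thesis
      using small x assms(2,3)
      by (subst splittable_swap12, subst splittable_sorted) (auto simp: obstructed_def obstructing_pair_def)
  next
    case 3
    then show ?thesis
      using small x assms(2,3)
      by (subst splittable_swap12, subst splittable_swap23, subst splittable_sorted)
         (auto simp: obstructed_def obstructing_pair_def)
  qed
  then show ?thesis by (simp add: split_step_def)
qed

lemma odd_cover_if_splittable:
  assumes "splittable (int m) x y z" "x + y + z = int m * int m"
  shows "odd_cover m x y z"
  using assms
proof (induction m arbitrary: x y z)
  case 0
  then show ?case by (auto simp: splittable_def Let_def max_def min_def split: if_splits)
next
  case (Suc m)
  from Suc.prems show ?case
  proof (induction x y z rule: sorted_triple_cases)
    case (swap12 x y z)
    then show ?case using odd_cover_swap12 splittable_swap12 by (metis add.commute)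
  next
    case (swap23 x y z)
    then show ?case using odd_cover_swap23 splittable_swap23 by (metis add.commute add.left_commute)
  next
    case (sorted x y z)
    have "split_step (int (Suc m)) x y z"
      using sorted by (intro split_step_exists) (auto simp: splittable_sorted)
    then consider
      "splittable (int m) (x - (2 * int m + 1)) y z" | "splittable (int m) x (y - (2 * int m + 1)) z"
      | "splittable (int m) x y (z - (2 * int m + 1))"
      by (auto simp: split_step_def algebra_simps split: if_splits)
    then show ?case
      by cases (use Suc.IH sorted(4) in \<open>auto simp: algebra_simps\<close>)
  qed
qed

lemma not_square_between:
  fixes m :: int
  assumes "k * k < j" "j < (k + 1) * (k + 1)" "0 \<le> k"
  shows "m * m \<noteq> j"
proof
  assume "m * m = j"
  then have "k\<^sup>2 < \<bar>m\<bar>\<^sup>2" "\<bar>m\<bar>\<^sup>2 < (k + 1)\<^sup>2" using assms by (auto simp: power2_eq_square)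
  then have "k < \<bar>m\<bar>" "\<bar>m\<bar> < k + 1"
    using assms(3) power2_less_imp_less[of k "\<bar>m\<bar>"] power2_less_imp_less[of "\<bar>m\<bar>" "k + 1"] by auto
  then show False by linarith
qed

text \<open>
  Values that \<open>m\<^sup>2\<close> would have to take in the degenerate cases of the arguments below, mostly those in
  which the largest length is as small as the middle one.
\<close>
definition nonsquares :: "int set" where
  "nonsquares = {2, 3, 5, 6, 7, 8, 10, 11, 12, 13, 14, 17, 18, 19, 21, 22, 23}"

lemma square_not_in_nonsquares:
  fixes m :: int
  shows "m * m \<notin> nonsquares"
proof
  assume "m * m \<in> nonsquares"
  then have "m * m \<in> {2, 3} \<or> m * m \<in> {5, 6, 7, 8} \<or> m * m \<in> {10, 11, 12, 13, 14} \<or>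
      m * m \<in> {17, 18, 19, 21, 22, 23}"
    unfolding nonsquares_def by blast
  then have "(1 < m * m \<and> m * m < 4) \<or> (4 < m * m \<and> m * m < 9) \<or> (9 < m * m \<and> m * m < 16) \<or>
      (16 < m * m \<and> m * m < 25)"
    by (elim disjE insertE emptyE) simp_all
  then show False
    using not_square_between[of 1 "m * m" m] not_square_between[of 2 "m * m" m] not_square_between[of 3 "m * m" m]
      not_square_between[of 4 "m * m" m] by (elim disjE) simp_all
qed

lemma odd_cover_slack0:
  assumes "0 \<le> z" "z \<le> y" "y \<le> x" "x + y + z = int m * int m" "\<not> obstructed (int m) x y z"
  shows "odd_cover m x y z"
  using assms by (intro odd_cover_if_splittable) (auto simp: splittable_sorted)

text \<open>
  A slack of one can be spent on any of the three lengths. If no choice helps, then all enlarged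
  triples are obstructed, which leaves few possibilities. The side conditions keep the triple
  sorted.
\<close>
lemma odd_cover_pad:
  assumes "\<forall>x y z. 0 \<le> z \<longrightarrow> z \<le> y \<longrightarrow> y \<le> x \<longrightarrow> x + y + z = M \<longrightarrow> odd_cover m x y z \<or> E x y z"
    and "0 \<le> z" "z \<le> y" "y \<le> x" "x + y + z = M - 1"
    and "\<not> odd_cover m x y z"
  shows "E (x + 1) y z" "y < x \<Longrightarrow> E x (y + 1) z" "z < y \<Longrightarrow> E x y (z + 1)"
  using assms odd_cover_mono[of m _ _ _ x y z] by (smt (verit))+

text \<open>
  Enlarging the largest length removes none of the obstructions given by the other two lengths, but
  enlarging one of those turns a \<open>2\<close> into a \<open>3\<close> and moves most obstructing pairs out of the list.
  What survives are the pairs all of whose neighbours are obstructing, and one triple.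
\<close>
lemma odd_cover_slack1:
  assumes "0 \<le> z" "z \<le> y" "y \<le> x" "x + y + z = int m * int m - 1"
    and "(y, z) \<notin> {(1, 1), (2, 2), (3, 2), (4, 2), (3, 3), (5, 5)}"
    and "\<not> (m = 5 \<and> (x, y, z) = (11, 11, 2))"
  shows "odd_cover m x y z"
proof (rule ccontr)
  assume a: "\<not> odd_cover m x y z"
  let ?E = "obstructed (int m)"
  have "\<forall>x y z. 0 \<le> z \<longrightarrow> z \<le> y \<longrightarrow> y \<le> x \<longrightarrow> x + y + z = int m * int m \<longrightarrow>
    odd_cover m x y z \<or> ?E x y z"
    using odd_cover_slack0[where m = m] by meson
  note E = odd_cover_pad[where E = ?E, OF this assms(1-4) a]
  have sum: "int m * int m = x + y + z + 1" using assms(4) by simp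
  have ns: "x + y + z + 1 \<notin> nonsquares"
    using square_not_in_nonsquares[of "int m"] unfolding sum .
  note defs = obstructed_def obstructing_pair_def sporadic_obstruction_def
  consider "x = 1" | "y = 2" | "z = 2" "y \<noteq> 2" | "obstructing_pair y z" | "sporadic_obstruction (int m) (x + 1) y z"
    using E(1) unfolding obstructed_def by linarith
  then show False
  proof cases
    case 1
    then have "y = 0 \<or> y = 1" "z = 0 \<or> z = 1" using assms(1-3) by auto
    then have "x + y + z + 1 \<in> nonsquares" using 1 assms(2,5) by (auto simp: nonsquares_def)
    then show ?thesis using ns by simp
  next
    case 2
    then have "z = 0 \<or> z = 1" using assms(1,2,5) by auto
    moreover have "x \<noteq> 2" using 2 calculation ns by (auto simp: nonsquares_def)
    ultimately have "y < x" "\<not> obstructed (int m) x (y + 1) z"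
      using 2 assms(3) by (auto simp: defs)
    then show ?thesis using E(2) by simp
  next
    case 3
    have "sporadic_obstruction (int m) x y 3 \<longleftrightarrow> m = 5 \<and> x = 11 \<and> y = 11" "obstructing_pair y 3 \<longleftrightarrow> y = 3 \<or> y = 4"
      by (auto simp: sporadic_obstruction_def obstructing_pair_def)
    moreover have "obstructed (int m) x y 3" "2 < y" using E(3) 3 assms(2) by simp_all
    ultimately show ?thesis using 3 assms(3,5,6) by (simp add: obstructed_def)
  next
    case 4
    have "y < x \<or> (x, y, z) = (10, 10, 4)"
    proof (cases "x = y")
      case True
      then have "x + y + z + 1 \<in> nonsquares \<or> (x, y, z) = (10, 10, 4)"
        using 4 assms(5) unfolding obstructing_pair_def by (elim insertE emptyE; simp add: nonsquares_def)
      then show ?thesis using ns by simp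
    qed (use assms(3) in simp)
    then show ?thesis
    proof
      assume "y < x"
      moreover have "\<not> obstructed (int m) x (y + 1) z"
        using 4 \<open>y < x\<close> assms(5) unfolding obstructing_pair_def by (elim insertE emptyE; simp add: defs)
      ultimately show ?thesis using E(2) by simp
    next
      assume "(x, y, z) = (10, 10, 4)"
      then have "z < y" "\<not> obstructed (int m) x y (z + 1)" by (auto simp: defs)
      then show ?thesis using E(3) by simp
    qed
  next
    case 5
    then have "y < x \<and> \<not> obstructed (int m) x (y + 1) z"
      using assms(3) unfolding sporadic_obstruction_def by (elim disjE conjE insertE emptyE; simp add: defs)
    then show ?thesis using E(2) by simp
  qed
qed

lemma odd_cover_slack2:
  assumes "0 \<le> z" "z \<le> y" "y \<le> x" "x + y + z = int m * int m - 2"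
    and "(y, z) \<notin> {(2, 2), (3, 2)}"
  shows "odd_cover m x y z"
proof (rule ccontr)
  assume a: "\<not> odd_cover m x y z"
  have b: "x + y + z = (int m * int m - 1) - 1" using assms(4) by simp
  let ?E = "(\<lambda>x y z. (y, z) \<in> {(1, 1), (2, 2), (3, 2), (4, 2), (3, 3), (5, 5)} \<or> m = 5 \<and> (x, y, z) = (11, 11, 2))"
  have "\<forall>x y z. 0 \<le> z \<longrightarrow> z \<le> y \<longrightarrow> y \<le> x \<longrightarrow> x + y + z = int m * int m - 1 \<longrightarrow>
    odd_cover m x y z \<or> ?E x y z"
    using odd_cover_slack1[where m = m] by meson
  note E = odd_cover_pad[where E = ?E, OF this assms(1-3) b a]
  have sum: "int m * int m = x + y + z + 2" using assms(4) by simp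
  have ns: "x + y + z + 2 \<notin> nonsquares"
    using square_not_in_nonsquares[of "int m"] unfolding sum .
  show False
  proof (cases "x = y")
    case True
    then have "x + y + z + 2 \<in> nonsquares" using E(1) assms(5) by (auto simp: nonsquares_def)
    then show ?thesis using ns by simp
  next
    case False
    then show ?thesis using E(1,2) assms(3,5) by auto
  qed
qed

lemma odd_cover_slack3:
  assumes "0 \<le> z" "z \<le> y" "y \<le> x" "x + y + z = int m * int m - 3"
    and "(y, z) \<noteq> (2, 2)"
  shows "odd_cover m x y z"
proof (rule ccontr)
  assume a: "\<not> odd_cover m x y z"
  have b: "x + y + z = (int m * int m - 2) - 1" using assms(4) by simp
  let ?E = "(\<lambda>x y z. (y, z) \<in> {(2, 2), (3, 2)})"
  have "\<forall>x y z. 0 \<le> z \<longrightarrow> z \<le> y \<longrightarrow> y \<le> x \<longrightarrow> x + y + z = int m * int m - 2 \<longrightarrow>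
    odd_cover m x y z \<or> ?E x y z"
    using odd_cover_slack2[where m = m] by meson
  note E = odd_cover_pad[where E = ?E, OF this assms(1-3) b a]
  have sum: "int m * int m = x + y + z + 3" using assms(4) by simp
  have ns: "x + y + z + 3 \<notin> nonsquares"
    using square_not_in_nonsquares[of "int m"] unfolding sum .
  have yz: "y = 3" "z = 2" using E(1) assms(5) by auto
  then have "\<not> y < x" using E(2) by auto
  then show False using ns yz assms(3) by (simp add: nonsquares_def)
qed

lemma odd_cover_slack4:
  assumes "0 \<le> z" "z \<le> y" "y \<le> x" "x + y + z \<le> int m * int m - 4"
  shows "odd_cover m x y z"
proof (rule ccontr)
  assume a: "\<not> odd_cover m x y z"
  define w where "w = int m * int m - 4 - y - z"
  have w: "w \<ge> x" "y \<le> w" "w + y + z = (int m * int m - 3) - 1" using assms by (auto simp: w_def)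
  have b: "\<not> odd_cover m w y z" using a odd_cover_mono w(1) by blast
  let ?E = "(\<lambda>x y z. (y, z) = (2, 2))"
  have "\<forall>x y z. 0 \<le> z \<longrightarrow> z \<le> y \<longrightarrow> y \<le> x \<longrightarrow> x + y + z = int m * int m - 3 \<longrightarrow>
    odd_cover m x y z \<or> ?E x y z"
    using odd_cover_slack3[where m = m] by meson
  note E = odd_cover_pad[where E = ?E, OF this assms(1,2) w(2,3) b]
  have sum: "int m * int m = w + y + z + 4" using w by simp
  have ns: "w + y + z + 4 \<notin> nonsquares"
    using square_not_in_nonsquares[of "int m"] unfolding sum .
  have yz: "y = 2" "z = 2" using E(1) by auto
  then have "\<not> y < w" using E(2) by auto
  then show False using ns yz w(2) by (simp add: nonsquares_def)
qed

text \<open>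
  With only two paths the only obstruction is a length \<open>2\<close> without any slack, since \<open>0\<close> occurs in
  no obstructing pair and in no sporadic triple.
\<close>
lemma odd_cover_two:
  assumes "x \<le> int m * int m" "y \<le> int m * int m" "x + y \<le> int m * int m"
    and "x + y = int m * int m \<Longrightarrow> x \<noteq> 2 \<and> y \<noteq> 2" and "z \<le> 0"
  shows "odd_cover m x y z"
proof -
  have sorted: "odd_cover m a b 0"
    if ab: "0 \<le> b" "b \<le> a" "a + b \<le> int m * int m" "a + b = int m * int m \<Longrightarrow> a \<noteq> 2 \<and> b \<noteq> 2" for a b
  proof -
    consider "a + b + 0 = int m * int m" | "a + b + 0 = int m * int m - 1"
      | "a + b + 0 = int m * int m - 2" | "a + b + 0 = int m * int m - 3"
      | "a + b + 0 \<le> int m * int m - 4"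
      using ab(3) by linarith
    then show ?thesis
    proof cases
      case 1
      have "\<not> obstructing_pair b 0" "\<not> sporadic_obstruction (int m) a b 0" by (auto simp: obstructing_pair_def sporadic_obstruction_def)
      then show ?thesis using 1 ab by (intro odd_cover_slack0) (auto simp: obstructed_def)
    next
      case 2
      then show ?thesis using ab odd_cover_slack1[of 0 b a m] by simp
    next
      case 3
      then show ?thesis using ab odd_cover_slack2[of 0 b a m] by simp
    next
      case 4
      then show ?thesis using ab odd_cover_slack3[of 0 b a m] by simp
    next
      case 5
      then show ?thesis using ab odd_cover_slack4[of 0 b a m] by simp
    qed
  qed
  have nsq: "int m * int m \<noteq> 2" using square_not_in_nonsquares[of "int m"] by (auto simp: nonsquares_def)
  let ?a = "max 0 x" and ?b = "max 0 y"
  have total: "?a + ?b \<le> int m * int m" "?a + ?b = int m * int m \<longrightarrow> ?a \<noteq> 2 \<and> ?b \<noteq> 2"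
    using assms(1-4) nsq by (auto simp: max_def)
  have "odd_cover m ?a ?b 0"
  proof (cases "?b \<le> ?a")
    case True
    then show ?thesis using sorted[of ?b ?a] total by simp
  next
    case False
    then have "odd_cover m ?b ?a 0" by (intro sorted) (use total in linarith)+
    then show ?thesis using odd_cover_swap12 by blast
  qed
  then show ?thesis by (rule odd_cover_mono) (use assms(5) in auto)
qed

section \<open>Exceptional triples and shifts of the largest ball\<close>

text \<open>
  The obstructions in the coordinates of the graph: for \<open>k = q - 1\<close>, a ball of radius \<open>k\<close> around the
  branch vertex reduces the cycle by \<open>2k + 1\<close> and each leg by \<open>k\<close>. The families \<open>C4\<close>, \<open>C5\<close>, \<open>C6\<close>
  distinguish whether the remainder of the cycle is the largest, the middle or the smallest length.
\<close>
lemma obstructed_imp_C4: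
  assumes "0 < z" "z \<le> y" "y \<le> x" "x + y + z = k * k" "0 \<le> k" "obstructed k x y z"
  shows "(x + 2 * k + 1, y + k, z + k) \<in> C4 (k + 1)"
proof -
  note sq = power2_eq_square algebra_simps
  have x: "x = k * k - y - z" using assms(4) by simp
  consider "z = 2" | "y = 2" "z = 1" | "x = 2" "y = 1" "z = 1" | "obstructing_pair y z" | "sporadic_obstruction k x y z"
    using assms(1-3,6) unfolding obstructed_def by linarith
  then show ?thesis
  proof cases
    case 1
    then show ?thesis using assms by (simp add: C4_def sq)
  next
    case 2
    then show ?thesis unfolding x by (simp add: C4_def B1_def sq)
  next
    case 3
    then show ?thesis using assms(4) by (simp add: C4_def B1_def sq)
  next
    case 4
    then show ?thesis unfolding obstructing_pair_def x C4_def B1_def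
      by (elim insertE emptyE) (simp_all add: sq)
  next
    case 5
    then show ?thesis unfolding sporadic_obstruction_def C4_def B4_def
      by (elim disjE conjE insertE emptyE) simp_all
  qed
qed

lemma obstructed_imp_C5:
  assumes "0 < z" "z \<le> x" "x \<le> y" "x + y + z = k * k" "0 \<le> k" "obstructed k y x z"
  shows "(x + 2 * k + 1, y + k, z + k) \<in> C5 (k + 1)"
proof -
  note sq = power2_eq_square algebra_simps
  have y: "y = k * k - x - z" using assms(4) by simp
  consider "z = 2" | "x = 2" "z = 1" | "obstructing_pair x z" | "sporadic_obstruction k y x z" | "y = 2" "x = 1" "z = 1"
    using assms(1-3,6) unfolding obstructed_def by linarith
  then show ?thesis
  proof cases
    case 1
    then show ?thesis using assms by (simp add: C5_def sq)
  next
    case 2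
    then show ?thesis unfolding y by (simp add: C5_def B2_def sq)
  next
    case 3
    then show ?thesis unfolding obstructing_pair_def y C5_def B2_def
      by (elim insertE emptyE) (simp_all add: sq)
  next
    case 4
    then show ?thesis unfolding sporadic_obstruction_def C5_def B5_def
      by (elim disjE conjE insertE emptyE) simp_all
  next
    case 5
    then show ?thesis using assms(4) by (simp add: C5_def B2_def sq)
  qed
qed

text \<open>
  If the remainder of the cycle ties with that of the shorter leg, the triple may be listed in \<open>C5\<close>
  instead.
\<close>
lemma obstructed_imp_C6:
  assumes "0 < x" "x \<le> z" "z \<le> y" "x + y + z = k * k" "0 \<le> k" "obstructed k y z x"
  shows "(x + 2 * k + 1, y + k, z + k) \<in> C5 (k + 1) \<union> C6 (k + 1)"
proof -
  note sq = power2_eq_square algebra_simps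
  have y: "y = k * k - x - z" using assms(4) by simp
  consider "x = 2" | "z = 2" "x = 1" | "obstructing_pair z x" | "sporadic_obstruction k y z x" | "y = 2" "x = 1" "z = 1"
    using assms(1-3,6) unfolding obstructed_def by linarith
  then show ?thesis
  proof cases
    case 1
    then show ?thesis using assms by (simp add: C6_def sq)
  next
    case 2
    then show ?thesis unfolding y by (simp add: C6_def B3_def sq)
  next
    case 3
    then show ?thesis unfolding obstructing_pair_def y C5_def B2_def C6_def B3_def
      by (elim insertE emptyE) (simp_all add: sq)
  next
    case 4
    then show ?thesis unfolding sporadic_obstruction_def C5_def B5_def C6_def B6_def
      by (elim disjE conjE insertE emptyE) simp_all
  next
    case 5
    then show ?thesis using assms(4) by (simp add: C5_def B2_def sq)
  qed
qed

text \<open>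
  The lengths left over when the largest ball is centred at the branch vertex, one step into the
  first leg, or one step into the second leg. A step shortens the rest of one leg by one, but lengthens
  the rest of the other leg by one and that of the cycle by two.
\<close>
definition shift_cover :: "nat \<Rightarrow> int \<Rightarrow> int \<Rightarrow> int \<Rightarrow> bool" where
  "shift_cover m x y z \<longleftrightarrow>
     odd_cover m x y z \<or> odd_cover m (x + 2) (y - 1) (z + 1) \<or> odd_cover m (x + 2) (y + 1) (z - 1)"

lemma odd_cover_tight_unless_exceptional:
  assumes "0 < x" "0 < z" "z \<le> y" "x + y + z = int m * int m"
    and "(x + 2 * int m + 1, y + int m, z + int m) \<notin> C4 (int m + 1) \<union> C5 (int m + 1) \<union> C6 (int m + 1)"
  shows "odd_cover m x y z"
proof -
  consider "y \<le> x" | "z \<le> x" "x \<le> y" | "x \<le> z" by linarith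
  then show ?thesis
  proof cases
    case 1
    then show ?thesis
      using odd_cover_slack0[of z y x m] obstructed_imp_C4[of z y x "int m"] assms by auto
  next
    case 2
    then have "odd_cover m y x z"
      using odd_cover_slack0[of z x y m] obstructed_imp_C5[of z x y "int m"] assms by auto
    then show ?thesis using odd_cover_swap12 by simp
  next
    case 3
    then have "odd_cover m y z x"
      using odd_cover_slack0[of x z y m] obstructed_imp_C6[of x z y "int m"] assms by auto
    then show ?thesis using odd_cover_swap12 odd_cover_swap23 by blast
  qed
qed

lemma odd_cover_slack1_unless_exceptional:
  assumes "0 < x" "0 < z" "z \<le> y" "x + y + z = int m * int m - 1"
    and "(x + 2 * int m + 1, y + int m, z + int m) \<notin> C3 (int m + 1)"
  shows "odd_cover m x y z"
proof -
  note sq = power2_eq_square algebra_simps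
  let ?P = "{(1, 1), (2, 2), (3, 2), (4, 2), (3, 3), (5, 5)} :: (int \<times> int) set"
  consider "y \<le> x" | "z \<le> x" "x \<le> y" | "x \<le> z" by linarith
  then show ?thesis
  proof cases
    case 1
    have x: "x = int m * int m - 1 - y - z" using assms(4) by simp
    have "(y, z) \<notin> ?P"
    proof
      assume "(y, z) \<in> ?P"
      then have "(x + 2 * int m + 1, y + int m, z + int m) \<in> C3 (int m + 1)"
        unfolding x C3_def by (elim insertE emptyE) (simp_all add: sq)
      then show False using assms(5) by simp
    qed
    moreover have "\<not> (m = 5 \<and> (x, y, z) = (11, 11, 2))"
    proof
      assume "m = 5 \<and> (x, y, z) = (11, 11, 2)"
      then have "(x + 2 * int m + 1, y + int m, z + int m) \<in> C3 (int m + 1)" by (simp add: C3_def)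
      then show False using assms(5) by simp
    qed
    ultimately show ?thesis using odd_cover_slack1 1 assms(2-4) by simp
  next
    case 2
    have y: "y = int m * int m - 1 - x - z" using assms(4) by simp
    have "(x, z) \<notin> ?P"
    proof
      assume "(x, z) \<in> ?P"
      then have "(x + 2 * int m + 1, y + int m, z + int m) \<in> C3 (int m + 1)"
        unfolding y C3_def by (elim insertE emptyE) (simp_all add: sq)
      then show False using assms(5) by simp
    qed
    moreover have "\<not> (m = 5 \<and> (y, x, z) = (11, 11, 2))"
    proof
      assume "m = 5 \<and> (y, x, z) = (11, 11, 2)"
      then have "(x + 2 * int m + 1, y + int m, z + int m) \<in> C3 (int m + 1)" by (simp add: C3_def)
      then show False using assms(5) by simp
    qed
    ultimately have "odd_cover m y x z" using odd_cover_slack1 2 assms(2-4) by simp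
    then show ?thesis using odd_cover_swap12 by simp
  next
    case 3
    have y: "y = int m * int m - 1 - x - z" using assms(4) by simp
    have "(z, x) \<notin> ?P"
    proof
      assume "(z, x) \<in> ?P"
      then have "(x + 2 * int m + 1, y + int m, z + int m) \<in> C3 (int m + 1)"
        unfolding y C3_def by (elim insertE emptyE) (simp_all add: sq)
      then show False using assms(5) by simp
    qed
    moreover have "\<not> (m = 5 \<and> (y, z, x) = (11, 11, 2))"
    proof
      assume "m = 5 \<and> (y, z, x) = (11, 11, 2)"
      then have "(x + 2 * int m + 1, y + int m, z + int m) \<in> C3 (int m + 1)" by (simp add: C3_def)
      then show False using assms(5) by simp
    qed
    ultimately have "odd_cover m y z x" using odd_cover_slack1 3 assms(1-4) by simp
    then show ?thesis using odd_cover_swap12 odd_cover_swap23 by blast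
  qed
qed

text \<open>
  Centring the ball at the branch vertex fails for the small pairs \<open>(2, 2)\<close> and \<open>(3, 2)\<close>. One step
  into a leg uses up the slack, and it helps when it turns such a pair into \<open>(3, 1)\<close> or \<open>(5, 1)\<close>.
\<close>
lemma shift_cover_slack2:
  assumes "0 < x" "0 < z" "z \<le> y" "x + y + z = int m * int m - 2"
    and "(x + 2 * int m + 1, y + int m, z + int m) \<notin> C2 (int m + 1)"
  shows "shift_cover m x y z"
proof -
  note sq = power2_eq_square algebra_simps
  consider "y \<le> x" | "z \<le> x" "x \<le> y" | "x \<le> z" by linarith
  then show ?thesis
  proof cases
    case 1
    consider "(y, z) \<notin> {(2, 2), (3, 2)}" | "y = 3" "z = 2" | "y = 2" "z = 2" by auto
    then show ?thesis
    proof cases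
      case 1
      then show ?thesis
        using odd_cover_slack2[of z y x m] \<open>y \<le> x\<close> assms(2-4) by (simp add: shift_cover_def)
    next
      case 2
      have "x = int m * int m - 7" using 2 assms(4) by simp
      then show ?thesis using assms(5) 2 by (simp add: C2_def sq)
    next
      case 3
      then have "odd_cover m (x + 2) 3 1"
        using \<open>y \<le> x\<close> assms(4)
        by (intro odd_cover_slack0) (auto simp: obstructed_def obstructing_pair_def sporadic_obstruction_def)
      then show ?thesis using 3 odd_cover_swap23 by (auto simp: shift_cover_def)
    qed
  next
    case 2
    consider "(x, z) \<notin> {(2, 2), (3, 2)}" | "x = 3" "z = 2" | "x = 2" "z = 2" by auto
    then show ?thesis
    proof cases
      case 1
      then have "odd_cover m y x z"
        using odd_cover_slack2[of z x y m] \<open>z \<le> x\<close> \<open>x \<le> y\<close> assms(2-4) by simp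
      then show ?thesis using odd_cover_swap12 by (simp add: shift_cover_def)
    next
      case 2
      have "int m * int m = y + 7" using 2 assms(4) by simp
      then have "y \<noteq> 3" using square_not_in_nonsquares[of "int m"] by (auto simp: nonsquares_def)
      then have "odd_cover m (y + 1) 5 1"
        using 2 \<open>x \<le> y\<close> assms(4)
        by (intro odd_cover_slack0) (auto simp: obstructed_def obstructing_pair_def sporadic_obstruction_def)
      then show ?thesis using 2 odd_cover_swap12 by (auto simp: shift_cover_def)
    next
      case 3
      have "y = int m * int m - 6" using 3 assms(4) by simp
      then show ?thesis using assms(5) 3 by (simp add: C2_def sq)
    qed
  next
    case 3
    have y: "y = int m * int m - 2 - x - z" using assms(4) by simp
    have "(z, x) \<notin> {(2, 2), (3, 2)}"
      using assms(5) unfolding y by (auto simp: C2_def sq)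
    then have "odd_cover m y z x"
      using odd_cover_slack2[of x z y m] 3 assms(1-4) by simp
    then show ?thesis using odd_cover_swap12 odd_cover_swap23 unfolding shift_cover_def by blast
  qed
qed

lemma shift_cover_slack3:
  assumes "0 < x" "0 < z" "z \<le> y" "x + y + z = int m * int m - 3"
  shows "shift_cover m x y z"
proof -
  consider "y \<le> x" | "z \<le> x" "x \<le> y" | "x < z" by linarith
  then show ?thesis
  proof cases
    case 1
    show ?thesis
    proof (cases "y = 2 \<and> z = 2")
      case True
      then have "odd_cover m (x + 3) 3 1"
        using 1 assms(4)
        by (intro odd_cover_slack0) (auto simp: obstructed_def obstructing_pair_def sporadic_obstruction_def)
      then have "odd_cover m (x + 2) 3 1" by (rule odd_cover_mono) auto
      then have "odd_cover m (x + 2) 1 3" using odd_cover_swap23 by blast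
      then show ?thesis using True by (auto simp: shift_cover_def)
    next
      case False
      then show ?thesis
        using odd_cover_slack3[of z y x m] 1 assms(2-4) by (simp add: shift_cover_def)
    qed
  next
    case 2
    show ?thesis
    proof (cases "x = 2 \<and> z = 2")
      case True
      have "int m * int m = y + 7" using True assms(4) by simp
      then have "y \<noteq> 3" using square_not_in_nonsquares[of "int m"] by (auto simp: nonsquares_def)
      then consider "y = 2" | "y \<ge> 4" using 2 True by linarith
      then have "odd_cover m 5 (y + 1) 1"
      proof cases
        case 1
        then show ?thesis
          using True assms(4)
          by (intro odd_cover_slack0) (auto simp: obstructed_def obstructing_pair_def sporadic_obstruction_def)
      next
        case 2
        then have "odd_cover m (y + 1) 5 1"
          using True assms(4)
          by (intro odd_cover_slack0) (auto simp: obstructed_def obstructing_pair_def sporadic_obstruction_def)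
        then show ?thesis using odd_cover_swap12 by simp
      qed
      then have "odd_cover m 4 (y + 1) 1" by (rule odd_cover_mono) auto
      then show ?thesis using True by (auto simp: shift_cover_def)
    next
      case False
      then have "odd_cover m y x z"
        using odd_cover_slack3[of z x y m] 2 assms(2-4) by simp
      then show ?thesis using odd_cover_swap12 by (simp add: shift_cover_def)
    qed
  next
    case 3
    then have "odd_cover m y z x"
      using odd_cover_slack3[of x z y m] assms(1-4) by simp
    then show ?thesis using odd_cover_swap12 odd_cover_swap23 unfolding shift_cover_def by blast
  qed
qed

lemma shift_cover_slack4:
  assumes "0 < x" "0 < z" "z \<le> y" "x + y + z \<le> int m * int m - 4"
  shows "shift_cover m x y z"
proof -
  consider "y \<le> x" | "z \<le> x" "x \<le> y" | "x \<le> z" by linarith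
  then have "odd_cover m x y z"
  proof cases
    case 1
    then show ?thesis using odd_cover_slack4 assms by simp
  next
    case 2
    then have "odd_cover m y x z" using odd_cover_slack4 assms by simp
    then show ?thesis using odd_cover_swap12 by simp
  next
    case 3
    then have "odd_cover m y z x" using odd_cover_slack4 assms by simp
    then show ?thesis using odd_cover_swap12 odd_cover_swap23 by blast
  qed
  then show ?thesis by (simp add: shift_cover_def)
qed

theorem shift_cover_unless_exceptional:
  assumes "0 < x" "0 < z" "z \<le> y" "x + y + z \<le> int m * int m"
    and "(x + 2 * int m + 1, y + int m, z + int m) \<notin>
      C2 (int m + 1) \<union> C3 (int m + 1) \<union> C4 (int m + 1) \<union> C5 (int m + 1) \<union> C6 (int m + 1)"
  shows "shift_cover m x y z"
proof -
  consider "x + y + z = int m * int m" | "x + y + z = int m * int m - 1"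
    | "x + y + z = int m * int m - 2" | "x + y + z = int m * int m - 3"
    | "x + y + z \<le> int m * int m - 4"
    using assms(4) by linarith
  then show ?thesis
    using odd_cover_tight_unless_exceptional[of x z y m] odd_cover_slack1_unless_exceptional[of x z y m] shift_cover_slack2[of x z y m]
      shift_cover_slack3[of x z y m] shift_cover_slack4[of x z y m] assms
    by cases (auto simp: shift_cover_def)
qed

section \<open>Balls and burning\<close>

fun ball :: "'a pair_pre_digraph \<Rightarrow> 'a \<Rightarrow> nat \<Rightarrow> 'a set" where
  "ball G v 0 = {v}"
| "ball G v (Suc d) = ball G v d \<union> nbrs G (ball G v d)"

lemma nbrs_mono: "S \<subseteq> T \<Longrightarrow> nbrs G S \<subseteq> nbrs G T"
  by (auto simp: nbrs_def)

lemma ball_mono: "d \<le> e \<Longrightarrow> ball G v d \<subseteq> ball G v e"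
  by (induction e) (auto simp: le_Suc_eq)

lemma ball_triangle: "w \<in> ball G v d \<Longrightarrow> ball G w e \<subseteq> ball G v (d + e)"
proof (induction e)
  case (Suc e)
  then show ?case using nbrs_mono[of "ball G w e" "ball G v (d + e)" G] by auto
qed auto

text \<open>
  Round \<open>t + 1\<close> lights the centre of the ball of radius \<open>k - 1 - t\<close>, which then has exactly that many
  rounds left to spread. If the centre already burns, any unburned vertex is lit instead.
\<close>
lemma burned_after_if_covered:
  assumes cover: "pverts G \<subseteq> (\<Union>i<k. ball G (c i) i)" and c: "\<And>i. i < k \<Longrightarrow> c i \<in> pverts G"
  shows "burned_after G k (pverts G)"
proof -
  have "\<exists>S. burned_after G t S \<and> (\<forall>i<t. ball G (c (k - 1 - i)) (t - 1 - i) \<subseteq> S)" if "t \<le> k" for t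
    using that
  proof (induction t)
    case 0
    show ?case using burned_after.start by auto
  next
    case (Suc t)
    then obtain S where S: "burned_after G t S"
      and balls: "\<And>i. i < t \<Longrightarrow> ball G (c (k - 1 - i)) (t - 1 - i) \<subseteq> S" by auto
    let ?v = "c (k - 1 - t)"
    have v: "?v \<in> pverts G" using c Suc.prems by simp
    obtain S' where S': "burned_after G (Suc t) S'" "S \<union> nbrs G S \<union> {?v} \<subseteq> S'"
    proof (cases "pverts G - S = {}")
      case True
      then have "S \<union> nbrs G S \<union> {?v} \<subseteq> S"
        using v burned_after_subset[OF S] by (auto simp: nbrs_def)
      then show ?thesis using that burned_after.finished[OF S True] by blast
    next
      case False
      then obtain u where "u \<in> pverts G - S" "?v \<notin> S \<longrightarrow> u = ?v" using v by blast
      then show ?thesis using that burned_after.ignite[OF S] by blast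
    qed
    have "ball G (c (k - 1 - i)) (Suc t - 1 - i) \<subseteq> S'" if "i < Suc t" for i
    proof (cases "i = t")
      case True
      then show ?thesis using S'(2) by simp
    next
      case False
      then have i: "i < t" "Suc t - 1 - i = Suc (t - 1 - i)" using that by auto
      show ?thesis
        using balls[OF i(1)] nbrs_mono[OF balls[OF i(1)], of G] S'(2) unfolding i(2) by auto
    qed
    then show ?case using S'(1) by blast
  qed
  from this[of k] obtain S where S: "burned_after G k S"
    and balls: "\<And>i. i < k \<Longrightarrow> ball G (c (k - 1 - i)) (k - 1 - i) \<subseteq> S" by auto
  have "ball G (c i) i \<subseteq> S" if "i < k" for i
    using balls[of "k - 1 - i"] that by simp
  then have "S = pverts G" using cover burned_after_subset[OF S] by blast
  then show ?thesis using S by simp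
qed

text \<open>
  The vertex lit in the last round has radius \<open>0\<close>; every earlier radius grows by one, hence the shift
  of the sequence of centres by \<open>case_nat\<close>.
\<close>
lemma covered_if_burned_after:
  assumes "burned_after G k S" "v \<in> pverts G"
  shows "\<exists>c. (\<forall>i<k. c i \<in> pverts G) \<and> S \<subseteq> (\<Union>i<k. ball G (c i) i)"
  using assms(1)
proof (induction rule: burned_after.induct)
  case start
  then show ?case by auto
next
  case (ignite t S w)
  then obtain c where c: "\<forall>i<t. c i \<in> pverts G" "S \<subseteq> (\<Union>i<t. ball G (c i) i)" by blast
  let ?c = "case_nat w c"
  have "S \<union> nbrs G S \<union> {w} \<subseteq> (\<Union>i<Suc t. ball G (?c i) i)"
  proof -
    have "S \<union> nbrs G S \<subseteq> (\<Union>i<t. ball G (c i) (Suc i))"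
      using c(2) by (fastforce simp: nbrs_def)
    then show ?thesis unfolding lessThan_Suc_eq_insert_0 by auto
  qed
  moreover have "\<forall>i<Suc t. ?c i \<in> pverts G" using c(1) ignite by (auto split: nat.split)
  ultimately show ?case by blast
next
  case (finished t S)
  then obtain c where c: "\<forall>i<t. c i \<in> pverts G" "S \<subseteq> (\<Union>i<t. ball G (c i) i)" by blast
  let ?c = "c(t := v)"
  have "(\<forall>i<Suc t. ?c i \<in> pverts G) \<and> S \<subseteq> (\<Union>i<Suc t. ball G (?c i) i)"
    using c assms(2) by (auto simp: less_Suc_eq) (fastforce simp: less_Suc_eq)
  then show ?case by blast
qed

lemma ball_on_line:
  assumes V: "\<And>i. lo \<le> i \<Longrightarrow> i \<le> hi \<Longrightarrow> f i \<in> pverts G"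
    and E: "\<And>i. lo \<le> i \<Longrightarrow> i < hi \<Longrightarrow> (f i, f (i + 1)) \<in> parcs G \<and> (f (i + 1), f i) \<in> parcs G"
    and "lo \<le> i" "i \<le> hi" "lo \<le> j" "j \<le> hi" "\<bar>i - j\<bar> \<le> int d"
  shows "f j \<in> ball G (f i) d"
  using assms(5-7)
proof (induction d arbitrary: j)
  case (Suc d)
  consider "\<bar>i - j\<bar> \<le> int d" | "j = i + int d + 1" | "j = i - int d - 1" using Suc.prems by linarith
  then show ?case
  proof cases
    case 1
    then show ?thesis using Suc by simp
  next
    case 2
    then have "f (j - 1) \<in> ball G (f i) d" using Suc assms(3) by auto
    then show ?thesis using E[of "j - 1"] V[of j] 2 Suc.prems assms(3) by (auto simp: nbrs_def)
  next
    case 3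
    then have "f (j + 1) \<in> ball G (f i) d" using Suc assms(4) by auto
    then show ?thesis using E[of j] V[of j] 3 Suc.prems assms(4) by (auto simp: nbrs_def)
  qed
qed auto

text \<open>
  The centre sits \<open>m + 1\<close> places into the segment, or at its end if the segment is shorter: the
  centre has to be a vertex.
\<close>
lemma ball_covers_initial_segment:
  assumes V: "\<And>i. lo \<le> i \<Longrightarrow> i \<le> hi \<Longrightarrow> f i \<in> pverts G"
    and E: "\<And>i. lo \<le> i \<Longrightarrow> i < hi \<Longrightarrow> (f i, f (i + 1)) \<in> parcs G \<and> (f (i + 1), f i) \<in> parcs G"
    and "lo \<le> u + 1" "u + x \<le> hi" "v \<in> pverts G"
  shows "\<exists>c\<in>pverts G. f ` {u + 1..u + x} \<subseteq> ball G c m \<union> f ` {u + (2 * int m + 1) + 1..u + x}"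
proof (cases "x \<le> 0")
  case True
  then show ?thesis using assms(5) by auto
next
  case False
  let ?p = "u + min (int m + 1) x"
  have "f j \<in> ball G (f ?p) m" if "u + 1 \<le> j" "j \<le> u + x" "j \<le> u + (2 * int m + 1)" for j
    using that False assms(3,4)
    by (intro ball_on_line[where f = f and lo = lo and hi = hi]) (use V E in auto)
  moreover have "f ?p \<in> pverts G" using V False assms(3,4) by simp
  moreover have "{u + 1..u + x} \<subseteq> {j. u + 1 \<le> j \<and> j \<le> u + x \<and> j \<le> u + (2 * int m + 1)} \<union>
      {u + (2 * int m + 1) + 1..u + x}" by auto
  ultimately show ?thesis by (intro bexI[of _ "f ?p"]) blast+
qed

lemma burning_number_le: "burned_after G k (pverts G) \<Longrightarrow> burning_number G \<le> k"
  unfolding burning_number_def by (rule Least_le)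

section \<open>Burning the unicyclic graph in \<open>q\<close> rounds\<close>

lemma pverts_unicyclic [simp]:
  "Cyc i \<in> pverts (unicyclic g a1 a2) \<longleftrightarrow> 1 \<le> i \<and> i \<le> g"
  "Leg1 i \<in> pverts (unicyclic g a1 a2) \<longleftrightarrow> 1 \<le> i \<and> i \<le> a1"
  "Leg2 i \<in> pverts (unicyclic g a1 a2) \<longleftrightarrow> 1 \<le> i \<and> i \<le> a2"
  by (auto simp: unicyclic_def)

text \<open>
  The three segments are consumed from their lower ends: an odd number \<open>2m + 1\<close> given to a
  segment stands for a ball of radius \<open>m\<close> on its first \<open>2m + 1\<close> vertices.
\<close>
lemma odd_cover_covers_segments:
  assumes "odd_cover m x y z" "3 \<le> g" "0 \<le> u" "u + x \<le> g" "0 \<le> v" "v + y \<le> a1" "0 \<le> w" "w + z \<le> a2"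
  defines "U \<equiv> unicyclic g a1 a2"
  shows "\<exists>c. (\<forall>i<m. c i \<in> pverts U) \<and>
    Cyc ` {u + 1..u + x} \<union> Leg1 ` {v + 1..v + y} \<union> Leg2 ` {w + 1..w + z} \<subseteq> (\<Union>i<m. ball U (c i) i)"
  using assms(1,3-8)
proof (induction m arbitrary: x y z u v w)
  case 0
  then show ?case by auto
next
  case (Suc m)
  have g: "Cyc g \<in> pverts U" using assms(2) by (simp add: U_def)
  let ?S = "\<lambda>u x v y w z. Cyc ` {u + 1..u + x} \<union> Leg1 ` {v + 1..v + y} \<union> Leg2 ` {w + 1..w + z}"
  let ?d = "2 * int m + 1"
  have extend: ?case
    if "\<exists>c. (\<forall>i<m. c i \<in> pverts U) \<and> T \<subseteq> (\<Union>i<m. ball U (c i) i)"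
      and "\<exists>c\<in>pverts U. ?S u x v y w z \<subseteq> ball U c m \<union> T" for T
  proof -
    from that obtain c b where c: "\<forall>i<m. c i \<in> pverts U" "T \<subseteq> (\<Union>i<m. ball U (c i) i)"
      and b: "b \<in> pverts U" "?S u x v y w z \<subseteq> ball U b m \<union> T" by blast
    let ?c = "c(m := b)"
    have "(\<Union>i<Suc m. ball U (?c i) i) = ball U b m \<union> (\<Union>i<m. ball U (c i) i)"
      by (auto simp: lessThan_Suc)
    moreover have "\<forall>i<Suc m. ?c i \<in> pverts U" using c(1) b(1) by (auto simp: less_Suc_eq)
    ultimately show ?thesis using c(2) b(2) by (intro exI[of _ ?c]) auto
  qed
  from Suc.prems(1) consider "odd_cover m (x - ?d) y z" | "odd_cover m x (y - ?d) z"
    | "odd_cover m x y (z - ?d)" by auto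
  then show ?case
  proof cases
    case 1
    have "\<exists>c\<in>pverts U. Cyc ` {u + 1..u + x} \<subseteq> ball U c m \<union> Cyc ` {u + ?d + 1..u + x}"
      using Suc.prems g
      by (intro ball_covers_initial_segment[where lo = 1 and hi = g])
         (auto simp: U_def unicyclic_def unicyclic_edges_def)
    then have "\<exists>c\<in>pverts U. ?S u x v y w z \<subseteq> ball U c m \<union> ?S (u + ?d) (x - ?d) v y w z"
      by simp blast
    then show ?thesis
      by (rule extend[rotated]) (use Suc.IH[OF 1, of "u + ?d" v w] Suc.prems in simp)
  next
    case 2
    have "\<exists>c\<in>pverts U. Leg1 ` {v + 1..v + y} \<subseteq> ball U c m \<union> Leg1 ` {v + ?d + 1..v + y}"
      using Suc.prems g
      by (intro ball_covers_initial_segment[where lo = 1 and hi = a1])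
         (auto simp: U_def unicyclic_def unicyclic_edges_def)
    then have "\<exists>c\<in>pverts U. ?S u x v y w z \<subseteq> ball U c m \<union> ?S u x (v + ?d) (y - ?d) w z"
      by simp blast
    then show ?thesis
      by (rule extend[rotated]) (use Suc.IH[OF 2, of u "v + ?d" w] Suc.prems in simp)
  next
    case 3
    have "\<exists>c\<in>pverts U. Leg2 ` {w + 1..w + z} \<subseteq> ball U c m \<union> Leg2 ` {w + ?d + 1..w + z}"
      using Suc.prems g
      by (intro ball_covers_initial_segment[where lo = 1 and hi = a2])
         (auto simp: U_def unicyclic_def unicyclic_edges_def)
    then have "\<exists>c\<in>pverts U. ?S u x v y w z \<subseteq> ball U c m \<union> ?S u x v y (w + ?d) (z - ?d)"
      by simp blast
    then show ?thesis
      by (rule extend[rotated]) (use Suc.IH[OF 3, of u v "w + ?d"] Suc.prems in simp)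
  qed
qed

text \<open>
  The distance from the branch vertex \<open>Cyc g\<close>.
\<close>
fun depth :: "int \<Rightarrow> uvertex \<Rightarrow> int" where
  "depth g (Cyc i) = min i (g - i)"
| "depth g (Leg1 i) = i"
| "depth g (Leg2 i) = i"

lemma in_ball_of_branch_vertex:
  assumes "3 \<le> g" "w \<in> pverts (unicyclic g a1 a2)"
  shows "w \<in> ball (unicyclic g a1 a2) (Cyc g) (nat (depth g w))"
proof (cases w)
  case (Cyc i)
  have "(\<lambda>k. if k = 0 then Cyc g else Cyc k) i \<in>
      ball (unicyclic g a1 a2) ((\<lambda>k. if k = 0 then Cyc g else Cyc k) 0) (nat i)"
    using assms Cyc by (intro ball_on_line[where lo = 0 and hi = g])
      (auto simp: unicyclic_def unicyclic_edges_def)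
  moreover have "Cyc i \<in> ball (unicyclic g a1 a2) (Cyc g) (nat (g - i))"
    using assms Cyc by (intro ball_on_line[where lo = 1 and hi = g])
      (auto simp: unicyclic_def unicyclic_edges_def)
  ultimately show ?thesis using assms Cyc by (auto simp: min_def)
next
  case (Leg1 i)
  have "(\<lambda>k. if k = 0 then Cyc g else Leg1 k) i \<in>
      ball (unicyclic g a1 a2) ((\<lambda>k. if k = 0 then Cyc g else Leg1 k) 0) (nat i)"
    using assms Leg1 by (intro ball_on_line[where lo = 0 and hi = a1])
      (auto simp: unicyclic_def unicyclic_edges_def)
  then show ?thesis using assms Leg1 by auto
next
  case (Leg2 i)
  have "(\<lambda>k. if k = 0 then Cyc g else Leg2 k) i \<in>
      ball (unicyclic g a1 a2) ((\<lambda>k. if k = 0 then Cyc g else Leg2 k) 0) (nat i)"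
    using assms Leg2 by (intro ball_on_line[where lo = 0 and hi = a2])
      (auto simp: unicyclic_def unicyclic_edges_def)
  then show ?thesis using assms Leg2 by auto
qed

lemma nonneg_depth: "w \<in> pverts (unicyclic g a1 a2) \<Longrightarrow> 0 \<le> depth g w"
  by (cases w) auto

lemma in_ball_around:
  assumes "3 \<le> g" "w \<in> pverts (unicyclic g a1 a2)"
    and "Cyc g \<in> ball (unicyclic g a1 a2) c e" "depth g w \<le> int m - int e"
  shows "w \<in> ball (unicyclic g a1 a2) c m"
proof -
  have "w \<in> ball (unicyclic g a1 a2) c (e + nat (depth g w))"
    using ball_triangle[OF assms(3)] in_ball_of_branch_vertex[OF assms(1,2)] by blast
  moreover have "e + nat (depth g w) \<le> m" using assms(4) nonneg_depth[OF assms(2)] by linarith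
  from ball_mono[OF this] have "ball (unicyclic g a1 a2) c (e + nat (depth g w)) \<subseteq> ball (unicyclic g a1 a2) c m" .
  ultimately show ?thesis by blast
qed

lemma burned_if_odd_cover:
  assumes "3 \<le> g" "odd_cover m x y z"
    and "0 \<le> u" "u + x \<le> g" "0 \<le> v" "v + y \<le> a1" "0 \<le> w" "w + z \<le> a2"
    and "c \<in> pverts (unicyclic g a1 a2)"
    and "pverts (unicyclic g a1 a2) \<subseteq> ball (unicyclic g a1 a2) c m \<union>
      (Cyc ` {u + 1..u + x} \<union> Leg1 ` {v + 1..v + y} \<union> Leg2 ` {w + 1..w + z})"
  shows "burned_after (unicyclic g a1 a2) (Suc m) (pverts (unicyclic g a1 a2))"
proof -
  let ?U = "unicyclic g a1 a2"
  obtain b where b: "\<forall>i<m. b i \<in> pverts ?U"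
    "Cyc ` {u + 1..u + x} \<union> Leg1 ` {v + 1..v + y} \<union> Leg2 ` {w + 1..w + z} \<subseteq> (\<Union>i<m. ball ?U (b i) i)"
    using odd_cover_covers_segments[OF assms(2,1,3-8)] by blast
  let ?b = "b(m := c)"
  have eq: "(\<Union>i<Suc m. ball ?U (?b i) i) = ball ?U c m \<union> (\<Union>i<m. ball ?U (b i) i)"
    by (auto simp: lessThan_Suc)
  have "pverts ?U \<subseteq> (\<Union>i<Suc m. ball ?U (?b i) i)"
    unfolding eq by (rule order.trans[OF assms(10) Un_mono[OF order.refl b(2)]])
  then show ?thesis
    using b(1) assms(9) by (intro burned_after_if_covered[where c = ?b]) (auto simp: less_Suc_eq)
qed

text \<open>
  The largest ball is centred at distance \<open>d\<close> from the branch vertex in the first leg (at the branch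
  vertex itself for \<open>d = 0\<close>). It reaches \<open>m + d\<close> vertices into that leg and, beyond the
  branch vertex, \<open>m - d\<close> vertices into the other leg and into both ends of the cycle.
\<close>
lemma burned_from_Leg1:
  assumes "3 \<le> g" "1 \<le> a1" "0 \<le> d" "d \<le> a1" "d \<le> int m"
    and "odd_cover m (g - 2 * (int m - d) - 1) (a1 - int m - d) (a2 - int m + d)"
  shows "burned_after (unicyclic g a1 a2) (Suc m) (pverts (unicyclic g a1 a2))"
proof -
  let ?U = "unicyclic g a1 a2"
  define f where "f k = (if k = 0 then Cyc g else Leg1 k)" for k
  have line: "f j \<in> ball ?U (f i) e" if "0 \<le> i" "i \<le> a1" "0 \<le> j" "j \<le> a1" "\<bar>i - j\<bar> \<le> int e" for i j e
    using that assms(1,2)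
    by (intro ball_on_line[where f = f and lo = 0 and hi = a1])
       (auto simp: f_def unicyclic_def unicyclic_edges_def)
  have "Cyc g \<in> ball ?U (f d) (nat d)" using line[of d 0 "nat d"] assms by (simp add: f_def)
  then have near: "w \<in> ball ?U (f d) m" if "w \<in> pverts ?U" "depth g w \<le> int m - d" for w
    using in_ball_around[OF assms(1) that(1)] that(2) assms(3) by simp
  have leg: "Leg1 j \<in> ball ?U (f d) m" if "1 \<le> j" "j \<le> a1" "j \<le> int m + d" for j
    using line[of d j m] that assms(3-5) by (simp add: f_def)
  have center: "f d \<in> pverts ?U" using assms by (simp add: f_def)
  have cover: "pverts ?U \<subseteq> ball ?U (f d) m \<union>
      (Cyc ` {int m - d + 1..int m - d + (g - 2 * (int m - d) - 1)} \<union>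
       Leg1 ` {int m + d + 1..int m + d + (a1 - int m - d)} \<union>
       Leg2 ` {int m - d + 1..int m - d + (a2 - int m + d)})"
    (is "_ \<subseteq> _ \<union> ?rest")
  proof
    fix w assume w: "w \<in> pverts ?U"
    show "w \<in> ball ?U (f d) m \<union> ?rest"
    proof (cases w)
      case (Cyc i)
      show ?thesis
      proof (cases "depth g w \<le> int m - d")
        case False
        then have "i \<in> {int m - d + 1..int m - d + (g - 2 * (int m - d) - 1)}" using Cyc by (auto simp: min_le_iff_disj)
        then show ?thesis unfolding Cyc by blast
      qed (use near[OF w] in simp)
    next
      case (Leg1 i)
      show ?thesis
      proof (cases "i \<le> int m + d")
        case True
        then show ?thesis using leg[of i] w unfolding Leg1 by simp
      next
        case False
        then have "i \<in> {int m + d + 1..int m + d + (a1 - int m - d)}" using w Leg1 by simp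
        then show ?thesis unfolding Leg1 by blast
      qed
    next
      case (Leg2 i)
      show ?thesis
      proof (cases "depth g w \<le> int m - d")
        case False
        then have "i \<in> {int m - d + 1..int m - d + (a2 - int m + d)}" using w Leg2 by simp
        then show ?thesis unfolding Leg2 by blast
      qed (use near[OF w] in simp)
    qed
  qed
  show ?thesis
    by (rule burned_if_odd_cover[OF assms(1,6) _ _ _ _ _ _ center cover]) (use assms in auto)
qed

lemma burned_from_Leg2:
  assumes "3 \<le> g" "1 \<le> a2" "0 \<le> d" "d \<le> a2" "d \<le> int m"
    and "odd_cover m (g - 2 * (int m - d) - 1) (a1 - int m + d) (a2 - int m - d)"
  shows "burned_after (unicyclic g a1 a2) (Suc m) (pverts (unicyclic g a1 a2))"
proof -
  let ?U = "unicyclic g a1 a2"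
  define f where "f k = (if k = 0 then Cyc g else Leg2 k)" for k
  have line: "f j \<in> ball ?U (f i) e" if "0 \<le> i" "i \<le> a2" "0 \<le> j" "j \<le> a2" "\<bar>i - j\<bar> \<le> int e" for i j e
    using that assms(1,2)
    by (intro ball_on_line[where f = f and lo = 0 and hi = a2])
       (auto simp: f_def unicyclic_def unicyclic_edges_def)
  have "Cyc g \<in> ball ?U (f d) (nat d)" using line[of d 0 "nat d"] assms by (simp add: f_def)
  then have near: "w \<in> ball ?U (f d) m" if "w \<in> pverts ?U" "depth g w \<le> int m - d" for w
    using in_ball_around[OF assms(1) that(1)] that(2) assms(3) by simp
  have leg: "Leg2 j \<in> ball ?U (f d) m" if "1 \<le> j" "j \<le> a2" "j \<le> int m + d" for j
    using line[of d j m] that assms(3-5) by (simp add: f_def)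
  have center: "f d \<in> pverts ?U" using assms by (simp add: f_def)
  have cover: "pverts ?U \<subseteq> ball ?U (f d) m \<union>
      (Cyc ` {int m - d + 1..int m - d + (g - 2 * (int m - d) - 1)} \<union>
       Leg1 ` {int m - d + 1..int m - d + (a1 - int m + d)} \<union>
       Leg2 ` {int m + d + 1..int m + d + (a2 - int m - d)})"
    (is "_ \<subseteq> _ \<union> ?rest")
  proof
    fix w assume w: "w \<in> pverts ?U"
    show "w \<in> ball ?U (f d) m \<union> ?rest"
    proof (cases w)
      case (Cyc i)
      show ?thesis
      proof (cases "depth g w \<le> int m - d")
        case False
        then have "i \<in> {int m - d + 1..int m - d + (g - 2 * (int m - d) - 1)}" using Cyc by (auto simp: min_le_iff_disj)
        then show ?thesis unfolding Cyc by blast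
      qed (use near[OF w] in simp)
    next
      case (Leg2 i)
      show ?thesis
      proof (cases "i \<le> int m + d")
        case True
        then show ?thesis using leg[of i] w unfolding Leg2 by simp
      next
        case False
        then have "i \<in> {int m + d + 1..int m + d + (a2 - int m - d)}" using w Leg2 by simp
        then show ?thesis unfolding Leg2 by blast
      qed
    next
      case (Leg1 i)
      show ?thesis
      proof (cases "depth g w \<le> int m - d")
        case False
        then have "i \<in> {int m - d + 1..int m - d + (a1 - int m + d)}" using w Leg1 by simp
        then show ?thesis unfolding Leg1 by blast
      qed (use near[OF w] in simp)
    qed
  qed
  show ?thesis
    by (rule burned_if_odd_cover[OF assms(1,6) _ _ _ _ _ _ center cover]) (use assms in auto)
qed

text \<open>
  With \<open>h = \<lfloor>g/2\<rfloor>\<close>, the distance \<open>d = m - h\<close> is the largest for which the ball still covers the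
  cycle. Reducing \<open>d\<close> by one keeps the cycle covered and moves a vertex from the rest of one leg to
  that of the other, so a remaining length \<open>2\<close> can be avoided whenever \<open>d > 0\<close>; for
  \<open>d = 0\<close>, that is, \<open>g \<in> {2m, 2m + 1}\<close>, it is the exception \<open>B_exc\<close>.
\<close>
lemma burned_small_cycle:
  assumes "3 \<le> g" "1 \<le> a2" "a2 \<le> a1" "g \<le> 2 * int m + 1" "1 \<le> m"
    and "a1 + g div 2 \<le> (int m + 1)^2 - 1" "a1 + a2 \<le> (int m + 1)^2 - 1"
    and "(g, a1, a2) \<notin> B_exc (int m + 1)"
  shows "burned_after (unicyclic g a1 a2) (Suc m) (pverts (unicyclic g a1 a2))"
proof -
  define h where "h = g div 2"
  have h: "2 * h \<le> g" "g \<le> 2 * h + 1" "h \<le> int m" "1 \<le> h" using assms(1,4) by (auto simp: h_def)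
  have sq: "(int m + 1)^2 = int m * int m + 2 * int m + 1" by (simp add: power2_eq_square algebra_simps)
  define d where "d = int m - h"
  define x where "x = a1 - int m - d"
  define y where "y = a2 - int m + d"
  have xy: "x \<le> int m * int m" "x + y \<le> int m * int m" 
    using assms(6,7) unfolding sq x_def y_def d_def h_def[symmetric] by linarith+
  show ?thesis
  proof (cases "d \<le> a1")
    case False
    \<comment> \<open>The longer leg has no vertex at distance \<open>d\<close>; then both legs lie in the ball around \<open>v\<^sub>g\<close>.\<close>
    have "odd_cover m (g - 2 * int m - 1) (a1 - int m) (a2 - int m)"
      using False assms h by (intro odd_cover_mono[where x = 0 and y = 0 and z = 0, OF odd_cover_two]) (auto simp: d_def)
    then show ?thesis using burned_from_Leg1[of g a1 0 m a2] assms by simp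
  next
    case True
    have y: "y \<le> int m * int m"
    proof (cases "x \<le> 0")
      case True
      then have "y \<le> 2 * int m - 2 * h" using assms(3) by (simp add: x_def y_def d_def)
      moreover have "2 * int m \<le> int m * int m + 1"
        using zero_le_square[of "int m - 1"] by (simp add: algebra_simps)
      ultimately show ?thesis using h by linarith
    qed (use xy in linarith)
    show ?thesis
    proof (cases "x + y = int m * int m \<and> (x = 2 \<or> y = 2)")
      case False
      then have "odd_cover m x y 0" using xy y by (intro odd_cover_two) auto
      then have "odd_cover m y 0 x" using odd_cover_swap12 odd_cover_swap23 by blast
      then have "odd_cover m 0 x y" using odd_cover_swap12 odd_cover_swap23 by blast
      then have "odd_cover m (g - 2 * (int m - d) - 1) x y"
        by (rule odd_cover_mono) (use h in \<open>auto simp: d_def\<close>)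
      then show ?thesis
        using burned_from_Leg1[of g a1 d m a2] assms True h by (simp add: x_def y_def d_def)
    next
      case exceptional: True
      then have sum: "int m * int m = x + y" by simp
      have "0 < d"
      proof (rule ccontr)
        assume "\<not> 0 < d"
        then have "h = int m" using h by (simp add: d_def)
        then have "(g = 2 * int m \<or> g = 2 * int m + 1) \<and> a1 = x + int m \<and> a2 = y + int m"
          using h by (auto simp: x_def y_def d_def)
        moreover have "y \<le> x" using \<open>h = int m\<close> assms(3) by (simp add: x_def y_def d_def)
        moreover have "y = 2"
        proof (rule ccontr)
          assume "y \<noteq> 2"
          then have "x = 2" using exceptional by simp
          then have "y < 2" "int m * int m = 2 + y" using \<open>y \<noteq> 2\<close> \<open>y \<le> x\<close> sum by auto
          moreover have "2 \<le> int m * int m" using xy(1) \<open>x = 2\<close> by simp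
          ultimately have "int m * int m \<in> nonsquares" by (cases "y = 0") (auto simp: nonsquares_def)
          then show False using square_not_in_nonsquares by blast
        qed
        moreover have "x = int m * int m - y" using sum by simp
        ultimately show False using assms(8)
          by (auto simp: B_exc_def power2_eq_square algebra_simps)
      qed
      have "odd_cover m (x + 1) (y - 1) 0"
      proof (rule odd_cover_two)
        have ns: "int m * int m \<notin> nonsquares" by (rule square_not_in_nonsquares)
        then have big: "4 \<le> int m * int m"
        proof -
          have "2 \<le> int m * int m" using exceptional xy(1) y by auto
          then show ?thesis using ns by (cases "int m * int m = 2"; cases "int m * int m = 3")
            (auto simp: nonsquares_def)
        qed
        show "x + 1 \<le> int m * int m" using exceptional big by auto
        show "y - 1 \<le> int m * int m" using y by simp
        show "x + 1 \<noteq> 2 \<and> y - 1 \<noteq> 2"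
        proof
          show "x + 1 \<noteq> 2" using exceptional big by auto
          show "y - 1 \<noteq> 2"
          proof
            assume "y - 1 = 2"
            then have "int m * int m = 5" using exceptional sum by simp
            then show False using ns by (simp add: nonsquares_def)
          qed
        qed
      qed (use exceptional in auto)
      then have "odd_cover m (y - 1) 0 (x + 1)" using odd_cover_swap12 odd_cover_swap23 by blast
      then have "odd_cover m 0 (x + 1) (y - 1)" using odd_cover_swap12 odd_cover_swap23 by blast
      then have shifted: "odd_cover m (g - 2 * (int m - (d - 1)) - 1) (x + 1) (y - 1)"
        by (rule odd_cover_mono) (use h in \<open>auto simp: d_def\<close>)
      have eqs: "a1 - int m - (d - 1) = x + 1" "a2 - int m + (d - 1) = y - 1"
        by (simp_all add: x_def y_def)
      show ?thesis
      proof (rule burned_from_Leg1[where d = "d - 1"])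
        show "odd_cover m (g - 2 * (int m - (d - 1)) - 1) (a1 - int m - (d - 1)) (a2 - int m + (d - 1))"
          unfolding eqs by (rule shifted)
      qed (use assms(1-3) True h \<open>0 < d\<close> in \<open>auto simp: d_def\<close>)
    qed
  qed
qed

lemma burned_large_cycle:
  assumes "1 \<le> a2" "a2 \<le> a1" "2 * int m + 2 \<le> g" "g \<le> (int m + 1)^2" "1 \<le> m"
    and n: "g + a1 + a2 = (int m + 1)^2 + r" "r \<le> 2 * int m" "r - int m \<le> a2"
    and exc: "(g, a1, a2) \<notin> C1 (int m + 1) r \<union> C2 (int m + 1) \<union> C3 (int m + 1) \<union>
      C4 (int m + 1) \<union> C5 (int m + 1) \<union> C6 (int m + 1)"
  shows "burned_after (unicyclic g a1 a2) (Suc m) (pverts (unicyclic g a1 a2))"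
proof -
  have g3: "3 \<le> g" using assms(3,5) by linarith
  have sq: "(int m + 1)^2 = int m * int m + 2 * int m + 1" by (simp add: power2_eq_square algebra_simps)
  define x y z where xyz: "x = g - 2 * int m - 1" "y = a1 - int m" "z = a2 - int m"
  have centre: ?thesis if "odd_cover m x y z"
    using burned_from_Leg1[of g a1 0 m a2] assms g3 that by (simp add: xyz)
  show ?thesis
  proof (cases "z \<le> 0")
    case True
    have "x \<le> int m * int m" using assms(4) by (simp add: xyz sq)
    moreover have "x + y \<le> int m * int m" using n by (simp add: xyz sq)
    moreover have "y \<le> int m * int m" using calculation(2) assms(3) by (simp add: xyz)
    moreover have "x \<noteq> 2 \<and> y \<noteq> 2" if "x + y = int m * int m"
    proof -
      have a2: "a2 = r - (int m + 1) + 1" using that n by (simp add: xyz sq)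
      have "(g, a1, a2) \<notin> C1 (int m + 1) r" using exc by simp
      then show ?thesis using that a2 unfolding xyz C1_def
        by (auto simp: power2_eq_square algebra_simps)
    qed
    ultimately have "odd_cover m x y z" using True by (intro odd_cover_two) auto
    then show ?thesis by (rule centre)
  next
    case False
    have "(g, a1, a2) = (x + 2 * int m + 1, y + int m, z + int m)" by (simp add: xyz)
    then have "shift_cover m x y z"
      using exc False assms(2,3) n
      by (intro shift_cover_unless_exceptional) (auto simp: xyz sq)
    then consider "odd_cover m x y z" | "odd_cover m (x + 2) (y - 1) (z + 1)"
      | "odd_cover m (x + 2) (y + 1) (z - 1)" unfolding shift_cover_def by blast
    then show ?thesis
    proof cases
      case 2
      have eqs: "g - 2 * (int m - 1) - 1 = x + 2" "a1 - int m - 1 = y - 1" "a2 - int m + 1 = z + 1"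
        by (auto simp: xyz)
      show ?thesis
      proof (rule burned_from_Leg1[where d = 1])
        show "odd_cover m (g - 2 * (int m - 1) - 1) (a1 - int m - 1) (a2 - int m + 1)"
          unfolding eqs by (rule 2)
      qed (use assms(1,2,5) g3 in auto)
    next
      case 3
      have eqs: "g - 2 * (int m - 1) - 1 = x + 2" "a1 - int m + 1 = y + 1" "a2 - int m - 1 = z - 1"
        by (auto simp: xyz)
      show ?thesis
      proof (rule burned_from_Leg2[where d = 1])
        show "odd_cover m (g - 2 * (int m - 1) - 1) (a1 - int m + 1) (a2 - int m - 1)"
          unfolding eqs by (rule 3)
      qed (use assms(1,2,5) g3 in auto)
    qed (rule centre)
  qed
qed

section \<open>Fewer than \<open>q\<close> rounds do not suffice\<close>

fun segment :: "uvertex \<Rightarrow> int \<Rightarrow> uvertex set" where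
  "segment (Cyc i) d = Cyc ` {i - d..i + d}"
| "segment (Leg1 i) d = Leg1 ` {i - d..i + d}"
| "segment (Leg2 i) d = Leg2 ` {i - d..i + d}"

lemma depth_le_along_arc:
  assumes "(v, w) \<in> parcs (unicyclic g a1 a2)" "3 \<le> g"
  shows "depth g w \<le> depth g v + 1"
  using assms by (auto simp: unicyclic_def unicyclic_edges_def)

lemma segment_along_arc:
  assumes "(v, w) \<in> parcs (unicyclic g a1 a2)" "v \<in> segment c d" "3 \<le> g"
    and "c \<in> pverts (unicyclic g a1 a2)" "w \<in> pverts (unicyclic g a1 a2)"
  shows "w \<in> segment c (d + 1) \<or> depth g c + depth g w \<le> d + 1"
  using assms by (cases c) (auto simp: unicyclic_def unicyclic_edges_def)

text \<open>
  A vertex of a ball is reached either within the arm of the centre or through the branch vertex; in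
  the second case its depth and that of the centre add up to at most the radius. The cycle counts as
  a single arm, cut open at the branch vertex.
\<close>
lemma ball_shape:
  assumes "3 \<le> g" "c \<in> pverts (unicyclic g a1 a2)" "w \<in> ball (unicyclic g a1 a2) c d"
  shows "w \<in> segment c (int d) \<or> depth g c + depth g w \<le> int d"
  using assms(3)
proof (induction d arbitrary: w)
  case 0
  then show ?case by (cases c) auto
next
  case (Suc d)
  show ?case
  proof (cases "w \<in> ball (unicyclic g a1 a2) c d")
    case True
    have "segment c (int d) \<subseteq> segment c (int (Suc d))" by (cases c) auto
    then show ?thesis using Suc.IH[OF True] by auto
  next
    case False
    then obtain v where v: "v \<in> ball (unicyclic g a1 a2) c d" "(v, w) \<in> parcs (unicyclic g a1 a2)"
      "w \<in> pverts (unicyclic g a1 a2)" using Suc.prems by (auto simp: nbrs_def)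
    from Suc.IH[OF v(1)] show ?thesis
    proof
      assume "v \<in> segment c (int d)"
      then show ?thesis using segment_along_arc[OF v(2) _ assms(1,2) v(3), of "int d"] by (simp add: add.commute)
    next
      assume "depth g c + depth g v \<le> int d"
      then show ?thesis using depth_le_along_arc[OF v(2) assms(1)] by simp
    qed
  qed
qed

lemma card_segment: "0 \<le> d \<Longrightarrow> int (card (segment c d)) \<le> 2 * d + 1"
  by (cases c) (simp_all add: card_image inj_on_def)

lemma card_three_arms:
  fixes A B C :: "int set"
  assumes "S \<subseteq> Cyc ` A \<union> Leg1 ` B \<union> Leg2 ` C" "finite A" "finite B" "finite C"
  shows "card S \<le> card A + card B + card C"
proof -
  have "card S \<le> card (Cyc ` A \<union> Leg1 ` B \<union> Leg2 ` C)" using assms by (intro card_mono) auto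
  also have "\<dots> \<le> card (Cyc ` A) + card (Leg1 ` B) + card (Leg2 ` C)"
    by (meson add_right_mono card_Un_le order_trans)
  also have "\<dots> \<le> card A + card B + card C"
    using assms by (intro add_mono card_image_le)
  finally show ?thesis .
qed

text \<open>
  Along the arm of the centre, the segment of up to \<open>2d + 1\<close> vertices is cut short by \<open>s\<close> at the
  branch vertex, while the core adds at most \<open>s\<close> vertices in each of the three other directions.
\<close>
lemma card_segment_with_core:
  assumes "3 \<le> g" "c \<in> pverts (unicyclic g a1 a2)" "s = d - depth g c" "0 \<le> s"
  shows "int (card ((segment c d \<union> {w. depth g w \<le> s}) \<inter> pverts (unicyclic g a1 a2)))
    \<le> 2 * d + 1 + 2 * s" (is "int (card ?S) \<le> _")
proof -
  let ?U = "unicyclic g a1 a2"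
  have two: "card ({1..a} \<union> {b..g}) \<le> nat a + nat (g - b + 1)" for a b :: int
    using card_Un_le[of "{1..a}" "{b..g}"] by simp
  have S: "?S \<subseteq> Cyc ` {i. 1 \<le> i \<and> i \<le> g \<and> (Cyc i \<in> segment c d \<or> i \<le> s \<or> g - s \<le> i)} \<union>
      Leg1 ` {i. 1 \<le> i \<and> i \<le> a1 \<and> (Leg1 i \<in> segment c d \<or> i \<le> s)} \<union>
      Leg2 ` {i. 1 \<le> i \<and> i \<le> a2 \<and> (Leg2 i \<in> segment c d \<or> i \<le> s)}" (is "_ \<subseteq> ?T")
  proof
    fix w assume "w \<in> ?S"
    then show "w \<in> ?T" by (cases w) auto
  qed
  show ?thesis
  proof (cases c)
    case (Cyc p)
    show ?thesis
    proof (cases "p \<le> g - p")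
      case True
      have "?S \<subseteq> Cyc ` ({1..p + d} \<union> {g - s..g}) \<union> Leg1 ` {1..s} \<union> Leg2 ` {1..s}"
        using Cyc True assms by (intro order.trans[OF S]) auto
      from card_three_arms[OF this] two[of "p + d" "g - s"] show ?thesis
        using Cyc True assms by simp
    next
      case False
      have "?S \<subseteq> Cyc ` ({1..s} \<union> {p - d..g}) \<union> Leg1 ` {1..s} \<union> Leg2 ` {1..s}"
        using Cyc False assms by (intro order.trans[OF S]) auto
      from card_three_arms[OF this] two[of s "p - d"] show ?thesis
        using Cyc False assms by simp
    qed
  next
    case (Leg1 p)
    have "?S \<subseteq> Cyc ` ({1..s} \<union> {g - s..g}) \<union> Leg1 ` {1..p + d} \<union> Leg2 ` {1..s}"
      using Leg1 assms by (intro order.trans[OF S]) auto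
    from card_three_arms[OF this] two[of s "g - s"] show ?thesis
      using Leg1 assms by (simp, arith)
  next
    case (Leg2 p)
    have "?S \<subseteq> Cyc ` ({1..s} \<union> {g - s..g}) \<union> Leg1 ` {1..s} \<union> Leg2 ` {1..p + d}"
      using Leg2 assms by (intro order.trans[OF S]) auto
    from card_three_arms[OF this] two[of s "g - s"] show ?thesis
      using Leg2 assms by (simp, arith)
  qed
qed

lemma sum_odd_int: "(\<Sum>i<k. 2 * int i + 1) = int k * int k"
  by (induction k) (auto simp: algebra_simps)

text \<open>
  The index \<open>j\<close> is chosen to maximise \<open>s\<close>, the radius that a ball has left at the branch
  vertex. The core of that ball contains everything that any other ball covers outside its own
  segment, so every other ball adds at most \<open>2i + 1\<close> vertices.
\<close>
lemma card_le_if_covered: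
  assumes "3 \<le> g" and c: "\<And>i. i < k \<Longrightarrow> c i \<in> pverts (unicyclic g a1 a2)"
    and cover: "pverts (unicyclic g a1 a2) \<subseteq> (\<Union>i<k. ball (unicyclic g a1 a2) (c i) i)"
  shows "int (card (pverts (unicyclic g a1 a2))) \<le> int k * int k + 2 * (int k - 1)"
proof -
  let ?U = "unicyclic g a1 a2"
  let ?V = "pverts ?U"
  define s where "s i = int i - depth g (c i)" for i
  have "Cyc g \<in> ?V" using assms(1) by simp
  then obtain i0 where i0: "i0 < k" "Cyc g \<in> ball ?U (c i0) i0" using cover by blast
  have s0: "0 \<le> s i0"
    using ball_shape[OF assms(1) c[OF i0(1)] i0(2)] assms(1)
    by (cases "c i0") (auto simp: s_def)
  have ne: "s ` {..<k} \<noteq> {}" using i0 by auto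
  obtain j where j: "j < k" "s j = Max (s ` {..<k})" using Max_in[OF _ ne] by auto
  then have max: "s i \<le> s j" if "i < k" for i using that by simp
  let ?core = "{w. depth g w \<le> s j}"
  let ?A = "(segment (c j) (int j) \<union> ?core) \<inter> ?V"
  let ?B = "\<Union>i\<in>{..<k} - {j}. segment (c i) (int i)"
  have fin: "finite (segment (c i) (int i))" for i by (cases "c i") auto
  have "?V \<subseteq> ?A \<union> ?B"
  proof
    fix w assume w: "w \<in> ?V"
    then obtain i where i: "i < k" "w \<in> ball ?U (c i) i" using cover by blast
    then have "w \<in> segment (c i) (int i) \<or> depth g w \<le> s i"
      using ball_shape[OF assms(1) c[OF i(1)] i(2)] by (auto simp: s_def)
    then show "w \<in> ?A \<union> ?B" using max[OF i(1)] i(1) w by (cases "i = j") auto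
  qed
  then have "card ?V \<le> card (?A \<union> ?B)"
    by (rule card_mono[rotated]) (auto simp: fin unicyclic_def)
  also have "\<dots> \<le> card ?A + card ?B" by (rule card_Un_le)
  also have "card ?B \<le> (\<Sum>i\<in>{..<k} - {j}. card (segment (c i) (int i)))"
    by (rule card_UN_le) simp
  finally have "int (card ?V) \<le> int (card ?A) + (\<Sum>i\<in>{..<k} - {j}. int (card (segment (c i) (int i))))"
    by (simp flip: of_nat_sum of_nat_add)
  also have "(\<Sum>i\<in>{..<k} - {j}. int (card (segment (c i) (int i)))) \<le> (\<Sum>i\<in>{..<k} - {j}. 2 * int i + 1)"
    by (intro sum_mono card_segment) simp
  also have "int (card ?A) \<le> 2 * int j + 1 + 2 * s j"
    using card_segment_with_core[OF assms(1) c[OF j(1)] s_def] max[OF i0(1)] s0 by simp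
  also have "(2 * int j + 1 + 2 * s j) + (\<Sum>i\<in>{..<k} - {j}. 2 * int i + 1) = int k * int k + 2 * s j"
    using sum.remove[of "{..<k}" j "\<lambda>i. 2 * int i + 1"] j(1) sum_odd_int[of k] by simp
  also have "s j \<le> int k - 1" using nonneg_depth[OF c[OF j(1)]] j(1) by (simp add: s_def)
  finally show ?thesis by simp
qed

lemma burning_number_unicyclic_lower:
  assumes "3 \<le> g" "1 \<le> a1" "1 \<le> a2" "q * q + 1 \<le> g + a1 + a2" "1 \<le> q"
  shows "q \<le> int (burning_number (unicyclic g a1 a2))"
proof (rule ccontr)
  let ?U = "unicyclic g a1 a2"
  let ?b = "int (burning_number ?U)"
  assume less: "\<not> q \<le> ?b"
  have "finite (pverts ?U)" by (simp add: unicyclic_def)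
  then have burned: "burned_after ?U (burning_number ?U) (pverts ?U)" by (rule burned_after_burning_number)
  have "Cyc g \<in> pverts ?U" using assms(1) by simp
  from covered_if_burned_after[OF burned this] obtain c where c: "\<forall>i<burning_number ?U. c i \<in> pverts ?U"
    "pverts ?U \<subseteq> (\<Union>i<burning_number ?U. ball ?U (c i) i)"
    by (elim exE conjE)
  have "g + a1 + a2 \<le> ?b * ?b + 2 * (?b - 1)"
    using card_le_if_covered[OF assms(1) _ c(2)] c(1) card_unicyclic[of g a1 a2] assms by simp
  moreover have "?b * ?b \<le> (q - 1) * (q - 1)" using less by (intro mult_mono) auto
  ultimately show False using less assms(4) by (simp add: algebra_simps)
qed

section \<open>The burning number\<close>

theorem theorem4p3:
  fixes g a1 a2 n q r :: int
  assumes "g \<ge> 3" and "a1 \<ge> a2" and "a2 \<ge> 1"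
    and "n = g + a1 + a2" and "n = q^2 + r"
    and "q \<ge> 1" and "1 \<le> r" and "r \<le> 2*q + 1"
    and "1 \<le> r" and "r \<le> 2*q - 2"
    and "(r + 1 \<le> g \<and> g \<le> 2*q - 1 \<and> a1 \<le> q^2 - \<lfloor>of_int g / (2::real)\<rfloor> - 1
            \<and> (g, a1, a2) \<notin> B_exc q)
       \<or> (2*q \<le> g \<and> g \<le> q^2 \<and> a2 \<ge> r - q + 1
            \<and> (g, a1, a2) \<notin> C1 q r \<union> C2 q \<union> C3 q \<union> C4 q \<union> C5 q \<union> C6 q)"
  shows "int (burning_number (unicyclic g a1 a2)) = \<lceil>sqrt (of_int n)\<rceil> - 1
       \<and> \<lceil>sqrt (of_int n)\<rceil> - 1 = q"
proof -
  let ?U = "unicyclic g a1 a2"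
  define m where "m = nat (q - 1)"
  have q: "q = int m + 1" "1 \<le> m" using assms(7,10) by (auto simp: m_def)
  have half: "\<lfloor>of_int g / (2::real)\<rfloor> = g div 2" using floor_divide_of_int_eq[of g 2] by simp
  have "burned_after ?U (Suc m) (pverts ?U)"
    using assms(11)
  proof
    assume "r + 1 \<le> g \<and> g \<le> 2*q - 1 \<and> a1 \<le> q^2 - \<lfloor>of_int g / (2::real)\<rfloor> - 1
            \<and> (g, a1, a2) \<notin> B_exc q"
    then show ?thesis
      using burned_small_cycle[of g a2 a1 m] assms(1-5) q unfolding half by simp
  next
    assume "2*q \<le> g \<and> g \<le> q^2 \<and> a2 \<ge> r - q + 1
            \<and> (g, a1, a2) \<notin> C1 q r \<union> C2 q \<union> C3 q \<union> C4 q \<union> C5 q \<union> C6 q"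
    then show ?thesis
      using burned_large_cycle[of a2 a1 m g r] assms(1-5,10) q by simp
  qed
  then have "int (burning_number ?U) \<le> q" using burning_number_le q(1) by fastforce
  moreover have "q \<le> int (burning_number ?U)"
    using burning_number_unicyclic_lower[of g a1 a2 q] assms(1-7) by (simp add: power2_eq_square)
  moreover have "\<lceil>sqrt (of_int n)\<rceil> = q + 1"
  proof (rule ceiling_unique)
    have "q^2 < n" "n \<le> (q + 1)^2" using assms(5,7,8) by (auto simp: power2_eq_square algebra_simps)
    then have "(of_int q)^2 < (of_int n :: real)" "(of_int n :: real) \<le> (of_int (q + 1))^2"
      by (metis of_int_less_iff of_int_power, metis of_int_le_iff of_int_power)
    then show "of_int (q + 1) - 1 < sqrt (of_int n)" "sqrt (of_int n) \<le> of_int (q + 1)"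
      using assms(6) by (auto intro: real_less_rsqrt real_le_lsqrt)
  qed
  ultimately show ?thesis by simp
qed

end
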